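(* Let $1<\alpha\le 2$, and let $\mathsf{P}_{\mathcal{M}}$ be the law on $(\mathcal{M},\mathcal{B}(\mathcal{M}))$ of the random vector field $v=\rho*\tilde v$ constructed from the Poisson point process in the context. Then the $\mathbb{R}^2$-system $(\{\theta^z\}_{z\in\mathbb{R}^2},\mathcal{M},\mathcal{B}(\mathcal{M}),\mathsf{P}_{\mathcal{M}})$ is polynomially mixing of order $\alpha-1$; that is, for every $N>0$ and all $A,B\in\mathcal{B}(\mathcal{M}_N)$, $$\limsup_{|z|_1\to\infty}|z|_1^{\alpha-1}\cdot\big|\mathsf{P}_{\mathcal{M}}(A\cap\theta^zB)-\mathsf{P}_{\mathcal{M}}(A)\,\mathsf{P}_{\mathcal{M}}(B)\big|<\infty.$$
   Context: Superscripts $1,2$ on points of $\mathbb{R}^2$ denote coordinates; $e_1,e_2$ is the standard basis of $\mathbb{R}^2$; $|z|_1=|z^1|+|z^2|$. Poisson process. Fix $1<\alpha\le 2$. Let $\Sigma=\{1,2\}$ and $\mathcal{X}=\mathbb{R}^2\times\mathbb{R}\times\mathbb{R}\times\Sigma$. Let $\omega=\{\eta_i=(x_i,r_i,\xi_i,\sigma_i):i\in\mathbb{N}\}$ be a Poisson point process on $\mathcal{X}$ (a random locally finite configuration) with intensity measure $$\mu(dx\times dr\times d\xi\times d\sigma)=\frac12\,\frac{\alpha e^{-r}}{\xi^{\alpha+1}}\mathbf{1}_{\{r\ge0,\ \xi\ge1\}}\,dx\,dr\,d\xi\,d\sigma,$$ where $dx,dr,d\xi$ are Lebesgue measures and $d\sigma$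 is counting measure on $\Sigma$. With probability one $x_i\ne x_j$ and $\xi_i\neq\xi_j$ for $i\ne j$, and one restricts to the full-measure set $\Omega$ of configurations with this property; $(\Omega,\mathcal{F},\mathsf{P})$ is the resulting probability space. Domains of influence. For $\eta=(x^1,x^2,r,\xi,\sigma)\in\mathcal{X}$ put $\mathrm{D}(\eta)=[x^1,x^1+r\xi]\times[x^2,x^2+1]$ if $\sigma=1$ and $\mathrm{D}(\eta)=[x^1,x^1+1]\times[x^2,x^2+r\xi]$ if $\sigma=2$. The number $\xi$ is called the strength of $\mathrm{D}(\eta)$. Vector field. For $x\in\mathbb{R}^2$, let $\phi(x)$ be the point $\eta\in\omega$ with the largest strength $\xi(\eta)$ among those $\eta\in\omega$ with $x\in\mathrm{D}(\eta)$; if there is no such $\eta$, set $\phi(x)=\Theta$, a special symbol. Define $\tilde v(x)=e_{\sigma(\phi(x))}$ if $\phi(x)\ne\Theta$ and $\tilde v(x)=\frac12(e_1+e_2)$ if $\phi(x)=\Theta$. (With probability one every bounded set in $\mathbb{R}^2$ meets only finitely many of the $\mathrm{D}(\eta_i)$, so $\phi$ is well defined; on the exceptional null event set $\tilde v\equiv\frac12(e_1+e_2)$.) Let $\rho$ be a fixed smooth probability density on $\mathbb{R}^2$ supported on $[-1/3,0]^2$, and let $v=\rho*\tilde v$ (convolution). Mixing. $\mathcal{M}$ is the space of continuous vector fields on $\mathbb{R}^2$ with the metric $d(u,w)=\sum_{n=1}^\infty 2^{-n}\min(\|u-w\|_{C([-n,n]^2)},1)$ and Borel $\sigma$-algebra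 $\mathcal{B}(\mathcal{M})$. $\mathsf{P}_{\mathcal{M}}$ is the push-forward of $\mathsf{P}$ under $\omega\mapsto v=v_\omega(\cdot)\in\mathcal{M}$. The shifts are $(\theta^zu)(x)=u(x+z)$, $z\in\mathbb{R}^2$; they preserve $\mathsf{P}_{\mathcal{M}}$ (they correspond to translating the points $x_i$ of the Poisson process to $x_i-z$), and $\theta^zB=\{\theta^zu:u\in B\}$. $\mathcal{M}_N$ is the space of vector fields restricted to the square $L_N=[-N,N]^2$, and $\mathcal{B}(\mathcal{M}_N)$ is viewed as the sub-$\sigma$-algebra of $\mathcal{B}(\mathcal{M})$ of events determined by the restriction $u|_{L_N}$. *)

theory Defs
  imports "HOL-Probability.Probability"
begin

section \<open>The Poisson process of marked points\<close>

type_synonym plane = "real \<times> real"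

text \<open>A point \<open>(x, r, \<xi>, \<sigma>)\<close>; the two elements of the numeral type \<open>2\<close> are \<open>1\<close> and \<open>2\<close>.\<close>

type_synonym point = "plane \<times> real \<times> real \<times> 2"

type_synonym config = "point set"

abbreviation location :: "point \<Rightarrow> plane"
  where "location \<eta> \<equiv> fst \<eta>"

abbreviation strength :: "point \<Rightarrow> real"
  where "strength \<eta> \<equiv> fst (snd (snd \<eta>))"

abbreviation orientation :: "point \<Rightarrow> 2"
  where "orientation \<eta> \<equiv> snd (snd (snd \<eta>))"

definition point_space :: "point measure"
  where "point_space = lborel \<Otimes>\<^sub>M lborel \<Otimes>\<^sub>M lborel \<Otimes>\<^sub>M count_space UNIV"

definition intensity :: "real \<Rightarrow> point measure"
  where "intensity \<alpha> = density point_space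
    (\<lambda>(x, r, \<xi>, \<sigma>). ennreal (if r \<ge> 0 \<and> \<xi> \<ge> 1
       then 1 / 2 * (\<alpha> * exp (- r) / \<xi> powr (\<alpha> + 1)) else 0))"

definition locally_finite :: "config \<Rightarrow> bool"
  where "locally_finite \<omega> \<longleftrightarrow>
    (\<forall>K. bounded K \<longrightarrow> finite {(x, r, \<xi>, \<sigma>). (x, r, \<xi>, \<sigma>) \<in> \<omega> \<and> (x, r, \<xi>) \<in> K})"

definition configs :: "config set"
  where "configs = {\<omega>. locally_finite \<omega> \<and> inj_on location \<omega> \<and> inj_on strength \<omega>}"

text \<open>Number of points of \<open>\<omega>\<close> in \<open>B\<close>, equal to \<open>\<infinity>\<close> if there are infinitely many.\<close>

definition num_points :: "point set \<Rightarrow> config \<Rightarrow> ennreal"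
  where "num_points B \<omega> = emeasure (count_space UNIV) (\<omega> \<inter> B)"

definition config_space :: "config measure"
  where "config_space = sigma configs
    {num_points B -` S \<inter> configs |B S. B \<in> sets point_space \<and> S \<in> sets borel}"

text \<open>
  \<open>P\<close> is the law of a Poisson point process with (\<open>\<sigma>\<close>-finite) intensity measure \<open>\<mu>\<close>. For a set \<open>B\<close>
  of infinite intensity, \<open>num_points B = \<infinity>\<close> almost surely is a consequence.
\<close>

definition poisson_process :: "point measure \<Rightarrow> config measure \<Rightarrow> bool"
  where "poisson_process \<mu> P \<longleftrightarrow>
    prob_space P \<and> sets P = sets config_space \<and>
    (\<forall>B\<in>sets \<mu>. emeasure \<mu> B < \<infinity> \<longrightarrow>
      (\<forall>k::nat. measure P {\<omega> \<in> space P. num_points B \<omega> = of_nat k} =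
         measure \<mu> B ^ k / fact k * exp (- measure \<mu> B))) \<and>
    (\<forall>\<B>. finite \<B> \<and> \<B> \<subseteq> sets \<mu> \<and> disjoint \<B> \<longrightarrow>
      prob_space.indep_vars P (\<lambda>_. borel) num_points \<B>)"


section \<open>The random vector field\<close>

definition influence :: "point \<Rightarrow> plane set"
  where "influence = (\<lambda>((x1, x2), r, \<xi>, \<sigma>).
    if \<sigma> = 1 then {x1..x1 + r * \<xi>} \<times> {x2..x2 + 1} else {x1..x1 + 1} \<times> {x2..x2 + r * \<xi>})"

definition finite_influence :: "config \<Rightarrow> bool"
  where "finite_influence \<omega> \<longleftrightarrow>
    (\<forall>K. bounded K \<longrightarrow> finite {\<eta> \<in> \<omega>. influence \<eta> \<inter> K \<noteq> {}})"

text \<open>\<open>None\<close> is the special symbol \<open>\<Theta>\<close>.\<close>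

definition strongest :: "config \<Rightarrow> plane \<Rightarrow> point option"
  where "strongest \<omega> x =
    (if \<exists>\<eta>\<in>\<omega>. x \<in> influence \<eta> then Some (arg_max_on strength {\<eta> \<in> \<omega>. x \<in> influence \<eta>})
     else None)"

definition unit_vec :: "2 \<Rightarrow> plane"
  where "unit_vec \<sigma> = (if \<sigma> = 1 then (1, 0) else (0, 1))"

definition raw_field :: "config \<Rightarrow> plane \<Rightarrow> plane"
  where "raw_field \<omega> x =
    (if finite_influence \<omega> then
       (case strongest \<omega> x of
          Some \<eta> \<Rightarrow> unit_vec (orientation \<eta>)
        | None \<Rightarrow> (1 / 2) *\<^sub>R (unit_vec 1 + unit_vec 2))
     else (1 / 2) *\<^sub>R (unit_vec 1 + unit_vec 2))"

primrec C_k :: "nat \<Rightarrow> (plane \<Rightarrow> real) \<Rightarrow> bool"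
  where
    "C_k 0 f \<longleftrightarrow> continuous_on UNIV f"
  | "C_k (Suc k) f \<longleftrightarrow> (\<forall>x. f differentiable at x) \<and>
       (\<forall>h. C_k k (\<lambda>x. frechet_derivative f (at x) h))"

definition smooth :: "(plane \<Rightarrow> real) \<Rightarrow> bool"
  where "smooth f \<longleftrightarrow> (\<forall>k. C_k k f)"

definition smoothing_kernel :: "(plane \<Rightarrow> real) \<Rightarrow> bool"
  where "smoothing_kernel \<rho> \<longleftrightarrow>
    smooth \<rho> \<and> (\<forall>x. \<rho> x \<ge> 0) \<and> integrable lborel \<rho> \<and> (\<integral>x. \<rho> x \<partial>lborel) = 1 \<and>
    closure {x. \<rho> x \<noteq> 0} \<subseteq> {- (1 / 3)..0} \<times> {- (1 / 3)..0}"

definition smooth_field :: "(plane \<Rightarrow> real) \<Rightarrow> config \<Rightarrow> plane \<Rightarrow> plane"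
  where "smooth_field \<rho> \<omega> x = (\<integral>y. \<rho> (x - y) *\<^sub>R raw_field \<omega> y \<partial>lborel)"


section \<open>The space of continuous vector fields\<close>

definition square :: "real \<Rightarrow> plane set"
  where "square N = {- N..N} \<times> {- N..N}"

definition vfields :: "(plane \<Rightarrow> plane) set"
  where "vfields = {u. continuous_on UNIV u}"

definition sup_dist :: "nat \<Rightarrow> (plane \<Rightarrow> plane) \<Rightarrow> (plane \<Rightarrow> plane) \<Rightarrow> real"
  where "sup_dist n u w = (SUP x\<in>square (real n). norm (u x - w x))"

text \<open>
  The series starts at the index \<open>0\<close>, so its \<open>n\<close>-th term is the one for the square of size
  \<open>n + 1\<close>. The value off \<open>vfields\<close> is irrelevant; it is set to \<open>0\<close> because \<^locale>\<open>Metric_space\<close> wants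
  a distance that is nonnegative on the whole type.
\<close>

definition vfield_dist :: "(plane \<Rightarrow> plane) \<Rightarrow> (plane \<Rightarrow> plane) \<Rightarrow> real"
  where "vfield_dist u w =
    (if u \<in> vfields \<and> w \<in> vfields
     then \<Sum>n. (1 / 2) ^ Suc n * min (sup_dist (Suc n) u w) 1 else 0)"

lemma compact_square: "compact (square N)"
  unfolding square_def by (intro compact_Times compact_Icc)

lemma zero_in_square: "0 \<in> square (real n)"
  by (auto simp: square_def zero_prod_def)

lemma bdd_above_sup_dist:
  assumes "u \<in> vfields" "w \<in> vfields"
  shows "bdd_above ((\<lambda>x. norm (u x - w x)) ` square (real n))"
proof -
  have "continuous_on (square (real n)) (\<lambda>x. norm (u x - w x))"
    using assms unfolding vfields_def
    by (auto intro!: continuous_intros elim: continuous_on_subset)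
  then show ?thesis
    by (intro bounded_imp_bdd_above compact_imp_bounded compact_continuous_image compact_square)
qed

lemma norm_le_sup_dist:
  assumes "u \<in> vfields" "w \<in> vfields" "x \<in> square (real n)"
  shows "norm (u x - w x) \<le> sup_dist n u w"
  unfolding sup_dist_def using assms by (intro cSUP_upper bdd_above_sup_dist)

lemma sup_dist_nonneg:
  assumes "u \<in> vfields" "w \<in> vfields"
  shows "0 \<le> sup_dist n u w"
  using norm_le_sup_dist[OF assms zero_in_square] norm_ge_zero order_trans by blast

lemma sup_dist_triangle:
  assumes "u \<in> vfields" "v \<in> vfields" "w \<in> vfields"
  shows "sup_dist n u w \<le> sup_dist n u v + sup_dist n v w"
  unfolding sup_dist_def[of n u w]
proof (rule cSUP_least)
  show "square (real n) \<noteq> {}"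
    using zero_in_square by blast
  fix x assume x: "x \<in> square (real n)"
  have "norm (u x - w x) \<le> norm (u x - v x) + norm (v x - w x)"
    using norm_triangle_ineq[of "u x - v x" "v x - w x"] by simp
  then show "norm (u x - w x) \<le> sup_dist n u v + sup_dist n v w"
    using norm_le_sup_dist[OF assms(1,2) x] norm_le_sup_dist[OF assms(2,3) x] by linarith
qed

lemma summable_vfield_dist:
  assumes "u \<in> vfields" "w \<in> vfields"
  shows "summable (\<lambda>n. (1 / 2) ^ Suc n * min (sup_dist (Suc n) u w) 1)"
proof (rule summable_comparison_test')
  show "summable (\<lambda>n. (1 / 2 :: real) ^ Suc n)"
    by (simp add: summable_Suc_iff summable_geometric)
  show "norm ((1 / 2) ^ Suc n * min (sup_dist (Suc n) u w) 1) \<le> (1 / 2) ^ Suc n" for n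
    using sup_dist_nonneg[OF assms, of "Suc n"] by (simp add: abs_mult)
qed

global_interpretation vfield: Metric_space vfields vfield_dist
proof
  fix u w
  have "0 \<le> vfield_dist u w" if uw: "u \<in> vfields" "w \<in> vfields"
    using suminf_nonneg[OF summable_vfield_dist[OF uw]] sup_dist_nonneg[OF uw] uw
    by (simp add: vfield_dist_def)
  then show "0 \<le> vfield_dist u w"
    by (cases "u \<in> vfields \<and> w \<in> vfields") (auto simp: vfield_dist_def)
  have "sup_dist n u w = sup_dist n w u" for n
    by (simp add: sup_dist_def norm_minus_commute)
  then show "vfield_dist u w = vfield_dist w u"
    unfolding vfield_dist_def by auto
next
  fix u w assume uw: "u \<in> vfields" "w \<in> vfields"
  let ?f = "\<lambda>n. (1 / 2) ^ Suc n * min (sup_dist (Suc n) u w) 1"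
  have nonneg: "0 \<le> ?f n" for n
    using sup_dist_nonneg[OF uw] by simp
  show "vfield_dist u w = 0 \<longleftrightarrow> u = w"
  proof
    assume "vfield_dist u w = 0"
    then have zero: "?f n = 0" for n
      using suminf_eq_zero_iff[OF summable_vfield_dist[OF uw] nonneg] uw
      by (simp add: vfield_dist_def)
    have zero': "sup_dist (Suc n) u w = 0" for n
      using zero[of n] by (auto simp: min_def split: if_splits)
    show "u = w"
    proof
      fix x :: plane
      obtain n where n: "max \<bar>fst x\<bar> \<bar>snd x\<bar> \<le> real n"
        using real_arch_simple by blast
      then have "x \<in> square (real (Suc n))"
        by (cases x) (auto simp: square_def)
      then have "norm (u x - w x) \<le> 0"
        using norm_le_sup_dist[OF uw] zero' by metis
      then show "u x = w x"
        by simp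
    qed
  next
    assume "u = w"
    have "sup_dist n w w = 0" for n
    proof -
      have "square (real n) \<noteq> {}"
        using zero_in_square by blast
      then show ?thesis
        by (simp add: sup_dist_def)
    qed
    with \<open>u = w\<close> show "vfield_dist u w = 0"
      by (simp add: vfield_dist_def)
  qed
next
  fix u v w assume uvw: "u \<in> vfields" "v \<in> vfields" "w \<in> vfields"
  have "min (sup_dist n u w) 1 \<le> min (sup_dist n u v) 1 + min (sup_dist n v w) 1" for n
    using sup_dist_triangle[OF uvw] sup_dist_nonneg[OF uvw(1,2)] sup_dist_nonneg[OF uvw(2,3)]
    by (smt (verit))
  then have "(1 / 2) ^ Suc n * min (sup_dist (Suc n) u w) 1 \<le>
      (1 / 2) ^ Suc n * min (sup_dist (Suc n) u v) 1 +
      (1 / 2) ^ Suc n * min (sup_dist (Suc n) v w) 1" for n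
    unfolding distrib_left[symmetric] by (intro mult_left_mono) auto
  then show "vfield_dist u w \<le> vfield_dist u v + vfield_dist v w"
    using uvw unfolding vfield_dist_def
    by (simp only: simp_thms if_True)
      (subst suminf_add, (rule summable_vfield_dist; assumption)+,
       intro suminf_le summable_add summable_vfield_dist; assumption)
qed

definition vfield_space :: "(plane \<Rightarrow> plane) measure"
  where "vfield_space = sigma vfields {U. openin vfield.mtopology U}"

text \<open>
  The Borel events that are determined by the restriction of the field to the square. Clamping the
  argument to the square is a continuous right inverse of restriction, so these are exactly the
  preimages under restriction of the Borel sets of \<open>C([-N, N]\<^sup>2)\<close>.
\<close>

definition local_events :: "real \<Rightarrow> (plane \<Rightarrow> plane) set set"
  where "local_events N =
    {A \<in> sets vfield_space. \<exists>S. A = {u \<in> vfields. restrict u (square N) \<in> S}}"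

definition field_law :: "(plane \<Rightarrow> real) \<Rightarrow> config measure \<Rightarrow> (plane \<Rightarrow> plane) measure"
  where "field_law \<rho> P = distr P vfield_space (smooth_field \<rho>)"


section \<open>Mixing\<close>

definition shift :: "plane \<Rightarrow> (plane \<Rightarrow> plane) \<Rightarrow> plane \<Rightarrow> plane"
  where "shift z u = (\<lambda>x. u (x + z))"

definition l1_norm :: "plane \<Rightarrow> real"
  where "l1_norm z = \<bar>fst z\<bar> + \<bar>snd z\<bar>"

definition polynomially_mixing :: "(plane \<Rightarrow> plane) measure \<Rightarrow> real \<Rightarrow> bool"
  where "polynomially_mixing Q \<beta> \<longleftrightarrow>
    (\<forall>N>0. \<forall>A\<in>local_events N. \<forall>B\<in>local_events N.
      Limsup (filtercomap l1_norm at_top)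
        (\<lambda>z. ereal (l1_norm z powr \<beta> * \<bar>measure Q (A \<inter> shift z ` B) - measure Q A * measure Q B\<bar>))
      < \<infinity>)"

end

theory Submission
  imports Defs
begin

text \<open>
  The field on a square \<open>[-N, N]\<^sup>2\<close> is decided by those points of the process whose domain of influence
  meets \<open>[-N - 1, N + 1]\<^sup>2\<close>, because the mollifier \<open>\<rho>\<close> looks at most \<open>1/3\<close> ahead. The field on the square
  translated by \<open>- z\<close> is decided in the same way by the points whose domain meets the translated window.
  Let \<open>D\<close> be the set of points that influence both windows. As long as no point of the process lies in
  \<open>D\<close>, the two fields are functions of the process restricted to two disjoint sets, and these
  restrictions are independent. Hence replacing the process by its restrictions costs at most the
  probability that \<open>D\<close> is hit, once in each of the three probabilities of the mixing expression
  (\<open>mixing_bound\<close>), and this probability is \<open>1 - exp (- \<mu> D) \<le> \<mu> D\<close>.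
  
  A domain of influence has width \<open>1\<close>, so for large \<open>z\<close> a point of \<open>D\<close> has to bridge a distance
  \<open>d = |z|\<^sub>1 - O(1)\<close> with the length \<open>r \<xi>\<close> of its domain. Integrating out the location, \<open>\<mu> D\<close> is at most a
  constant times the mean of \<open>(r \<xi> - d)\<^sup>+\<close>, and as \<open>\<xi>\<close> has the tail \<open>\<xi>\<^sup>-\<^sup>\<alpha>\<close> this mean is of order
  \<open>d\<^sup>1\<^sup>-\<^sup>\<alpha>\<close> (\<open>tail_integral_le\<close>, \<open>measure_meeting_two_windows\<close>). This is the rate \<open>\<alpha> - 1\<close>.
  
  Independence and stationarity of the process both follow from one formula, the void probability
  \<open>P (\<omega> \<inter> B = {}) = exp (- \<mu> B)\<close>. Void events are closed under intersection, as
  \<open>\<omega> \<inter> B = {}\<close> and \<open>\<omega> \<inter> C = {}\<close> together say \<open>\<omega> \<inter> (B \<union> C) = {}\<close>; so the \<open>\<pi>\<close>-\<open>\<lambda>\<close> theorem extends every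
  identity that holds for them to the \<open>\<sigma>\<close>-algebra \<open>void_space\<close> that they generate
  (\<open>prob_restrict_indep\<close>, \<open>prob_image_invariant\<close>). For this to apply, the field has to be measurable with
  respect to \<open>void_space\<close>, and jointly in the configuration and the location so that it can be mollified.
  \<open>threshold_field\<close> is a version of it that is written with countably many void events and agrees with it
  on every element of \<open>configs\<close> with \<open>finite_influence\<close>, hence almost surely.
\<close>

section \<open>Borel sets of the space of continuous fields\<close>

lemma sup_dist_mono:
  assumes "u \<in> vfields" "w \<in> vfields" "m \<le> n"
  shows "sup_dist m u w \<le> sup_dist n u w"
  unfolding sup_dist_def[of m]
proof (rule cSUP_least)
  show "square (real m) \<noteq> {}"
    using zero_in_square by blast
  fix x assume "x \<in> square (real m)"
  with \<open>m \<le> n\<close> have "x \<in> square (real n)"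
    by (auto simp: square_def)
  then show "norm (u x - w x) \<le> sup_dist n u w"
    by (rule norm_le_sup_dist[OF assms(1,2)])
qed

text \<open>
  The first \<open>n\<close> terms of the series are controlled by the supremum over the largest square involved and
  the rest by the geometric tail, so a neighbourhood of a field only constrains it on one square.
\<close>

lemma vfield_dist_le:
  assumes uw: "u \<in> vfields" "w \<in> vfields"
  shows "vfield_dist u w \<le> sup_dist n u w + (1 / 2) ^ n"
proof -
  let ?f = "\<lambda>i. (1 / 2) ^ Suc i * min (sup_dist (Suc i) u w) 1"
  have geo: "(\<lambda>i. (1 / 2) ^ Suc i) sums (1 :: real)"
    using power_half_series by simp
  have "vfield_dist u w = (\<Sum>i. ?f (i + n)) + (\<Sum>i<n. ?f i)"
    using uw suminf_split_initial_segment[OF summable_vfield_dist[OF uw], of n]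
    by (simp add: vfield_dist_def)
  also have "(\<Sum>i. ?f (i + n)) \<le> (\<Sum>i. (1 / 2) ^ n * (1 / 2) ^ Suc i)"
  proof (rule suminf_le)
    show "?f (i + n) \<le> (1 / 2) ^ n * (1 / 2) ^ Suc i" for i
      using mult_left_mono[of "min (sup_dist (Suc (i + n)) u w) 1" 1 "(1/2) ^ Suc (i + n)"]
      by (simp add: power_add mult_ac)
    show "summable (\<lambda>i. ?f (i + n))"
      using summable_ignore_initial_segment[OF summable_vfield_dist[OF uw]] by simp
    show "summable (\<lambda>i. (1 / 2 :: real) ^ n * (1 / 2) ^ Suc i)"
      using geo by (intro summable_mult) (rule sums_summable)
  qed
  also have "\<dots> = (1 / 2) ^ n"
    using sums_mult[OF geo, of "(1 / 2) ^ n"] by (simp add: sums_iff)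
  also have "(\<Sum>i<n. ?f i) \<le> (\<Sum>i<n. (1 / 2) ^ Suc i * sup_dist n u w)"
    by (intro sum_mono mult_left_mono min.coboundedI1 sup_dist_mono uw) auto
  also have "\<dots> = (\<Sum>i<n. (1 / 2) ^ Suc i) * sup_dist n u w"
    by (simp add: sum_distrib_right)
  also have "\<dots> \<le> 1 * sup_dist n u w"
    using sum_le_suminf[OF sums_summable[OF geo], of "{..<n}"] geo
    by (intro mult_right_mono sup_dist_nonneg uw) (auto simp: sums_iff)
  finally show ?thesis by simp
qed

lemma vfield_nbhd:
  assumes "openin vfield.mtopology U" "u \<in> U"
  obtains n :: nat and e :: real where "0 < e"
    "\<And>w. w \<in> vfields \<Longrightarrow> \<forall>x\<in>square (real n). norm (u x - w x) \<le> e \<Longrightarrow> w \<in> U"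
proof -
  obtain r where r: "0 < r" "vfield.mball u r \<subseteq> U"
    using assms by (auto simp: vfield.openin_mtopology)
  have u: "u \<in> vfields"
    using openin_subset[OF assms(1)] assms(2) by auto
  obtain n where n: "(1 / 2) ^ n < r / 2"
    using real_arch_pow_inv[of "r / 2" "1 / 2"] r by auto
  show ?thesis
  proof (rule that[of "r / 2" n])
    fix w assume w: "w \<in> vfields" and near: "\<forall>x\<in>square (real n). norm (u x - w x) \<le> r / 2"
    have "sup_dist n u w \<le> r / 2"
      unfolding sup_dist_def using near zero_in_square by (intro cSUP_least) auto
    then have "vfield_dist u w < r"
      using vfield_dist_le[OF u w, of n] n by simp
    then show "w \<in> U"
      using r u w by (auto simp: vfield.in_mball)
  qed (use r in simp)
qed

lemma openin_vfields: "{U. openin vfield.mtopology U} \<subseteq> Pow vfields"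
  using openin_subset[of vfield.mtopology] by simp blast

lemma space_vfield_space [simp]: "space vfield_space = vfields"
  unfolding vfield_space_def by (rule space_measure_of[OF openin_vfields])

lemma measurable_eval: "(\<lambda>u. u x) \<in> borel_measurable vfield_space"
proof (rule borel_measurableI)
  fix S :: "plane set" assume "open S"
  have "openin vfield.mtopology {u \<in> vfields. u x \<in> S}"
    unfolding vfield.openin_mtopology
  proof (intro conjI ballI allI impI)
    fix u assume u: "u \<in> {u \<in> vfields. u x \<in> S}"
    then obtain e where e: "0 < e" "\<And>y. dist y (u x) < e \<Longrightarrow> y \<in> S"
      using \<open>open S\<close> by (auto simp: open_dist)
    obtain n where n: "max \<bar>fst x\<bar> \<bar>snd x\<bar> \<le> real n"
      using real_arch_simple by blast
    then have x: "x \<in> square (real (Suc n))"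
      by (cases x) (auto simp: square_def)
    let ?c = "(1 / 2 :: real) ^ Suc n"
    have "vfield.mball u (?c * min e 1) \<subseteq> {u \<in> vfields. u x \<in> S}"
    proof
      fix w assume "w \<in> vfield.mball u (?c * min e 1)"
      then have w: "w \<in> vfields" "vfield_dist u w < ?c * min e 1"
        by (auto simp: vfield.in_mball)
      have uw: "u \<in> vfields" "w \<in> vfields" using u w by auto
      have "?c * min (sup_dist (Suc n) u w) 1 \<le> vfield_dist u w"
        using sum_le_suminf[OF summable_vfield_dist[OF uw], of "{n}"] sup_dist_nonneg[OF uw] uw
        by (simp add: vfield_dist_def)
      then have "?c * min (sup_dist (Suc n) u w) 1 < ?c * min e 1"
        using w by linarith
      then have "min (sup_dist (Suc n) u w) 1 < min e 1"
        by (subst (asm) mult_less_cancel_left_pos) auto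
      then have "norm (u x - w x) < e"
        using norm_le_sup_dist[OF uw x] by linarith
      then show "w \<in> {u \<in> vfields. u x \<in> S}"
        using e uw by (auto simp: dist_norm norm_minus_commute)
    qed
    then show "\<exists>r>0. vfield.mball u r \<subseteq> {u \<in> vfields. u x \<in> S}"
      using e by (intro exI[of _ "?c * min e 1"]) auto
  qed auto
  then have "{u \<in> vfields. u x \<in> S} \<in> sets vfield_space"
    unfolding vfield_space_def by (intro in_measure_of[OF openin_vfields]) simp
  then show "(\<lambda>u. u x) -` S \<inter> space vfield_space \<in> sets vfield_space"
    by (simp add: vimage_def Int_def conj_commute)
qed

text \<open>
  The metric topology is that of uniform convergence on compact sets, and it is second countable: a
  neighbourhood of \<open>u\<close> contains a set \<open>V F\<close> of fields that are within \<open>1/(k + 1)\<close> of finitely many values on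
  finitely many basic open sets covering a square, and there are countably many such \<open>V F\<close>. Membership
  in \<open>V F\<close> needs to be tested only at points of a countable dense set. So the evaluations generate the
  Borel sets, and a random field is measurable as soon as its value at each location is.
\<close>

lemma measurable_vfield_spaceI:
  assumes f: "\<And>\<omega>. \<omega> \<in> space M \<Longrightarrow> f \<omega> \<in> vfields"
    and ev: "\<And>x. (\<lambda>\<omega>. f \<omega> x) \<in> borel_measurable M"
  shows "f \<in> M \<rightarrow>\<^sub>M vfield_space"
  unfolding vfield_space_def
proof (rule measurable_measure_of)
  show "{U. openin vfield.mtopology U} \<subseteq> Pow vfields"
    by (rule openin_vfields)
  show "f \<in> space M \<rightarrow> vfields"
    using f by auto
  fix U assume "U \<in> {U. openin vfield.mtopology U}"
  then have U: "openin vfield.mtopology U" by simp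
  have U_sub: "U \<subseteq> vfields" using openin_subset[OF U] by simp
  obtain \<O> :: "plane set set" where \<O>: "countable \<O>" "topological_basis \<O>"
    using ex_countable_basis by blast
  obtain D :: "plane set"
    where D: "countable D" "\<And>X. open X \<Longrightarrow> X \<noteq> {} \<Longrightarrow> \<exists>d\<in>D. d \<in> X"
    using countable_dense_setE by blast
  define T where "T = \<O> \<times> D \<times> (UNIV :: nat set)"
  define V where "V F = {u \<in> vfields. \<forall>(Q, q, k)\<in>F. \<forall>x\<in>Q \<inter> D. dist (u x) q \<le> 1 / Suc k}" for F
  have "countable T"
    using \<O>(1) D(1) by (auto simp: T_def)
  \<comment> \<open>compactness of the square reduces the approximation of \<open>u\<close> to finitely many basic sets\<close>
  have local: "\<exists>F. finite F \<and> F \<subseteq> T \<and> u \<in> V F \<and> V F \<subseteq> U" if "u \<in> U" for u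
  proof -
    have u: "u \<in> vfields" using that U_sub by auto
    obtain n e where e: "0 < e"
      and near: "\<And>w. w \<in> vfields \<Longrightarrow> \<forall>x\<in>square (real n). norm (u x - w x) \<le> e \<Longrightarrow> w \<in> U"
      using vfield_nbhd[OF U \<open>u \<in> U\<close>] by blast
    obtain k where k: "1 / Suc k < e / 2"
      using e nat_approx_posE[of "e / 2"] by auto
    define \<C> where "\<C> = {Q \<in> \<O>. \<exists>q\<in>D. \<forall>y\<in>Q. dist (u y) q \<le> 1 / Suc k}"
    have "square (real n) \<subseteq> \<Union>\<C>"
    proof
      fix x :: plane assume "x \<in> square (real n)"
      obtain q where q: "q \<in> D" "q \<in> ball (u x) (1 / Suc k)"
        using D(2)[of "ball (u x) (1 / Suc k)"] by auto
      have "open {y. dist (u y) q < 1 / Suc k}"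
        using u unfolding vfields_def by (intro open_Collect_less continuous_intros) auto
      moreover have "x \<in> {y. dist (u y) q < 1 / Suc k}"
        using q by simp
      ultimately obtain Q where "Q \<in> \<O>" "x \<in> Q" "Q \<subseteq> {y. dist (u y) q < 1 / Suc k}"
        using topological_basisE[OF \<O>(2)] by blast
      then show "x \<in> \<Union>\<C>"
        using q unfolding \<C>_def by (auto intro: less_imp_le)
    qed
    moreover have "open Q" if "Q \<in> \<C>" for Q
      using that topological_basis_open[OF \<O>(2)] by (auto simp: \<C>_def)
    ultimately obtain \<C>' where \<C>': "\<C>' \<subseteq> \<C>" "finite \<C>'" "square (real n) \<subseteq> \<Union>\<C>'"
      using compactE[OF compact_square] by metis
    have "\<forall>Q\<in>\<C>'. \<exists>q. q \<in> D \<and> (\<forall>y\<in>Q. dist (u y) q \<le> 1 / Suc k)"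
      using \<C>'(1) unfolding \<C>_def by blast
    then obtain c where c: "\<And>Q. Q \<in> \<C>' \<Longrightarrow> c Q \<in> D"
        "\<And>Q y. Q \<in> \<C>' \<Longrightarrow> y \<in> Q \<Longrightarrow> dist (u y) (c Q) \<le> 1 / Suc k"
      by metis
    define F where "F = (\<lambda>Q. (Q, c Q, k)) ` \<C>'"
    have "finite F" "F \<subseteq> T" "u \<in> V F"
      using \<C>' c u by (auto simp: F_def T_def V_def \<C>_def)
    moreover have "V F \<subseteq> U"
    proof
      fix w assume "w \<in> V F"
      then have w: "w \<in> vfields"
          and wF: "\<And>Q x. Q \<in> \<C>' \<Longrightarrow> x \<in> Q \<inter> D \<Longrightarrow> dist (w x) (c Q) \<le> 1 / Suc k"
        by (auto simp: V_def F_def)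
      have "norm (u x - w x) \<le> e" if x: "x \<in> square (real n)" for x
      proof -
        obtain Q where Q: "Q \<in> \<C>'" "x \<in> Q" using \<C>'(3) x by blast
        have "open Q"
          using Q \<C>'(1) topological_basis_open[OF \<O>(2)] by (auto simp: \<C>_def)
        have op: "open (Q \<inter> {y. 1 / Suc k < dist (w y) (c Q)})"
          using w \<open>open Q\<close> unfolding vfields_def
          by (intro open_Int open_Collect_less continuous_intros) auto
        \<comment> \<open>the estimate extends from the dense set to all of the open set \<open>Q\<close> by continuity\<close>
        have "dist (w x) (c Q) \<le> 1 / Suc k"
        proof (rule ccontr)
          assume "\<not> dist (w x) (c Q) \<le> 1 / Suc k"
          then have "Q \<inter> {y. 1 / Suc k < dist (w y) (c Q)} \<noteq> {}"
            using Q(2) by auto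
          then obtain d where "d \<in> Q \<inter> D" "1 / Suc k < dist (w d) (c Q)"
            using D(2)[OF op] by auto
          then show False
            using wF[OF Q(1), of d] by linarith
        qed
        then have "dist (u x) (w x) \<le> 1 / Suc k + 1 / Suc k"
          using c(2)[OF Q] dist_triangle2[of "u x" "w x" "c Q"] by linarith
        then show ?thesis
          using k by (simp add: dist_norm)
      qed
      with near w show "w \<in> U" by blast
    qed
    ultimately show ?thesis by blast
  qed
  define \<F> where "\<F> = {F. finite F \<and> F \<subseteq> T \<and> V F \<subseteq> U}"
  have "countable \<F>"
    by (rule countable_subset[OF _ countable_Collect_finite_subset[OF \<open>countable T\<close>]])
       (auto simp: \<F>_def)
  have meas: "f -` V F \<inter> space M \<in> sets M" if "F \<in> \<F>" for F
  proof -
    have *: "countable F" "\<And>Q. countable (Q \<inter> D)"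
      using that D(1) by (auto simp: \<F>_def intro: countable_finite)
    have "f -` V F \<inter> space M =
        {\<omega> \<in> space M. \<forall>t\<in>F. \<forall>x\<in>fst t \<inter> D. dist (f \<omega> x) (fst (snd t)) \<le> 1 / Suc (snd (snd t))}"
      using f by (auto simp: V_def split_beta')
    also have "\<dots> \<in> sets M"
    proof (rule sets.sets_Collect_countable_All'[OF _ *(1)], rule sets.sets_Collect_countable_All'[OF _ *(2)])
      fix x t
      note ev[measurable]
      show "{\<omega> \<in> space M. dist (f \<omega> x) (fst (snd t)) \<le> 1 / Suc (snd (snd t))} \<in> sets M"
        by measurable
    qed
    finally show ?thesis .
  qed
  have "U = (\<Union>F\<in>\<F>. V F)"
  proof
    show "U \<subseteq> (\<Union>F\<in>\<F>. V F)"
    proof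
      fix u assume "u \<in> U"
      from local[OF this] show "u \<in> (\<Union>F\<in>\<F>. V F)"
        by (auto simp: \<F>_def)
    qed
  qed (auto simp: \<F>_def)
  then have "f -` U \<inter> space M = (\<Union>F\<in>\<F>. f -` V F \<inter> space M)"
    by auto
  also have "\<dots> \<in> sets M"
    using \<open>countable \<F>\<close> meas by (intro sets.countable_UN') auto
  finally show "f -` U \<inter> space M \<in> sets M" .
qed

lemma shift_vfields [simp]: "shift z u \<in> vfields \<longleftrightarrow> u \<in> vfields"
proof -
  have "shift z u \<in> vfields" if "u \<in> vfields" for z u
    using continuous_on_compose2[of UNIV u UNIV "\<lambda>x. x + z"] that
    by (simp add: vfields_def shift_def continuous_on_add)
  from this[of u z] this[of "shift z u" "- z"] show ?thesis
    by (auto simp: shift_def)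
qed

lemma measurable_shift_field [measurable]: "shift z \<in> vfield_space \<rightarrow>\<^sub>M vfield_space"
proof (rule measurable_vfield_spaceI)
  show "(\<lambda>u. shift z u x) \<in> borel_measurable vfield_space" for x
    unfolding shift_def by (rule measurable_eval)
qed simp

lemma shift_image: "shift z ` B = {u. shift (- z) u \<in> B}"
proof -
  have "shift z (shift (- z) u) = u" "shift (- z) (shift z u) = u" for u
    by (auto simp: shift_def)
  then show ?thesis by (auto intro: rev_image_eqI)
qed

lemma sets_shift_image:
  assumes "B \<in> sets vfield_space"
  shows "shift z ` B \<in> sets vfield_space"
proof -
  have "shift z ` B = shift (- z) -` B \<inter> space vfield_space"
    using sets.sets_into_space[OF assms] by (auto simp: shift_image)
  then show ?thesis
    using measurable_sets[OF measurable_shift_field assms] by simp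
qed

section \<open>Void probabilities of the Poisson process\<close>

definition void :: "point set \<Rightarrow> config set"
  where "void B = {\<omega>. \<omega> \<inter> B = {}}"

text \<open>
  The carrier consists of all subsets of the point space, so that restricting and translating
  configurations are maps of this space into itself.
\<close>

definition void_space :: "point measure \<Rightarrow> config measure"
  where "void_space \<mu> = sigma UNIV {void B |B. B \<in> sets \<mu> \<and> emeasure \<mu> B < \<infinity>}"

lemma space_void_space [simp]: "space (void_space \<mu>) = UNIV"
  by (simp add: void_space_def)

lemma void_in_void_space:
  "B \<in> sets \<mu> \<Longrightarrow> emeasure \<mu> B < \<infinity> \<Longrightarrow> void B \<in> sets (void_space \<mu>)"
  unfolding void_space_def by (intro in_measure_of) auto

lemma measurable_void_spaceI:
  assumes "\<And>B. B \<in> sets \<mu> \<Longrightarrow> emeasure \<mu> B < \<infinity> \<Longrightarrow> {x \<in> space M. f x \<inter> B = {}} \<in> sets M"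
  shows "f \<in> M \<rightarrow>\<^sub>M void_space \<mu>"
  unfolding void_space_def
proof (rule measurable_measure_of)
  fix V assume "V \<in> {void B |B. B \<in> sets \<mu> \<and> emeasure \<mu> B < \<infinity>}"
  then obtain B where "V = void B" "B \<in> sets \<mu>" "emeasure \<mu> B < \<infinity>"
    by blast
  moreover have "f -` void B \<inter> space M = {x \<in> space M. f x \<inter> B = {}}"
    by (auto simp: void_def)
  ultimately show "f -` V \<inter> space M \<in> sets M"
    using assms by simp
qed auto

lemma measurable_restrict_config:
  assumes "E \<in> sets \<mu>"
  shows "(\<lambda>\<omega>. \<omega> \<inter> E) \<in> void_space \<mu> \<rightarrow>\<^sub>M void_space \<mu>"
proof (rule measurable_void_spaceI)
  fix B assume B: "B \<in> sets \<mu>" "emeasure \<mu> B < \<infinity>"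
  have "emeasure \<mu> (E \<inter> B) < \<infinity>"
    using emeasure_mono[of "E \<inter> B" B \<mu>] B by (auto intro: le_less_trans)
  then have "void (E \<inter> B) \<in> sets (void_space \<mu>)"
    using assms B by (intro void_in_void_space) auto
  then show "{\<omega> \<in> space (void_space \<mu>). \<omega> \<inter> E \<inter> B = {}} \<in> sets (void_space \<mu>)"
    by (simp add: void_def Int_assoc)
qed

lemma measurable_image_config:
  assumes f: "f \<in> \<mu> \<rightarrow>\<^sub>M \<mu>" and inv: "distr \<mu> \<mu> f = \<mu>" and sp: "space \<mu> = UNIV"
  shows "(\<lambda>\<omega>. f ` \<omega>) \<in> void_space \<mu> \<rightarrow>\<^sub>M void_space \<mu>"
proof (rule measurable_void_spaceI)
  fix B assume B: "B \<in> sets \<mu>" "emeasure \<mu> B < \<infinity>"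
  have "emeasure \<mu> (f -` B) = emeasure \<mu> B"
    using emeasure_distr[OF f B(1)] by (simp add: inv sp)
  moreover have "f -` B \<in> sets \<mu>"
    using measurable_sets[OF f B(1)] by (simp add: sp)
  ultimately have "void (f -` B) \<in> sets (void_space \<mu>)"
    using B by (intro void_in_void_space) auto
  moreover have "{\<omega> \<in> space (void_space \<mu>). f ` \<omega> \<inter> B = {}} = void (f -` B)"
    by (auto simp: void_def)
  ultimately show "{\<omega> \<in> space (void_space \<mu>). f ` \<omega> \<inter> B = {}} \<in> sets (void_space \<mu>)"
    by simp
qed

lemma num_points_eq_0: "num_points B \<omega> = 0 \<longleftrightarrow> \<omega> \<inter> B = {}"
  by (simp add: num_points_def emeasure_count_space_eq_0)

lemma num_points_eq_of_nat: "num_points B \<omega> = of_nat k \<longleftrightarrow> finite (\<omega> \<inter> B) \<and> card (\<omega> \<inter> B) = k"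
proof (cases "finite (\<omega> \<inter> B)")
  case False
  then show ?thesis
    using of_nat_less_top[of k]
    by (auto simp: num_points_def emeasure_count_space_infinite)
qed (simp add: num_points_def emeasure_count_space_finite)

lemma num_points_less_top: "num_points B \<omega> < \<infinity> \<longleftrightarrow> finite (\<omega> \<inter> B)"
  by (cases "finite (\<omega> \<inter> B)")
     (simp_all add: num_points_def emeasure_count_space_finite emeasure_count_space_infinite
       of_nat_less_top)

locale poisson =
  fixes \<mu> :: "point measure" and P :: "config measure"
  assumes poisson: "poisson_process \<mu> P" and sets_intensity: "sets \<mu> = sets point_space"

sublocale poisson \<subseteq> prob_space P
  using poisson by (simp add: poisson_process_def)

context poisson begin

lemma space_P: "space P = configs"
  using sets_eq_imp_space_eq[of P config_space] poisson
  by (simp add: poisson_process_def config_space_def space_measure_of_conv)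

lemma num_points_measurable:
  assumes "B \<in> sets \<mu>" shows "num_points B \<in> borel_measurable P"
proof (rule borel_measurableI)
  fix S :: "ennreal set" assume "open S"
  then have "num_points B -` S \<inter> configs \<in>
      {num_points B -` S \<inter> configs |B S. B \<in> sets point_space \<and> S \<in> sets borel}"
    using assms unfolding sets_intensity by (intro CollectI exI[of _ B] exI[of _ S]) simp
  then have "num_points B -` S \<inter> configs \<in> sets config_space"
    unfolding config_space_def by (rule in_measure_of[rotated]) auto
  then show "num_points B -` S \<inter> space P \<in> sets P"
    using poisson by (simp add: space_P poisson_process_def)
qed

lemma void_event:
  assumes "B \<in> sets \<mu>" shows "{\<omega> \<in> space P. \<omega> \<inter> B = {}} \<in> events"
proof -
  note num_points_measurable[OF assms, measurable]
  have "{\<omega> \<in> space P. num_points B \<omega> = 0} \<in> events" by measurable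
  then show ?thesis by (simp add: num_points_eq_0)
qed

lemma finite_event:
  assumes "B \<in> sets \<mu>" shows "{\<omega> \<in> space P. finite (\<omega> \<inter> B)} \<in> events"
proof -
  note num_points_measurable[OF assms, measurable]
  have "{\<omega> \<in> space P. num_points B \<omega> < \<infinity>} \<in> events" by measurable
  then show ?thesis by (simp only: num_points_less_top)
qed

lemma prob_void:
  assumes "B \<in> sets \<mu>" "emeasure \<mu> B < \<infinity>"
  shows "prob {\<omega> \<in> space P. \<omega> \<inter> B = {}} = exp (- measure \<mu> B)"
proof -
  have "prob {\<omega> \<in> space P. num_points B \<omega> = of_nat 0} =
      measure \<mu> B ^ 0 / fact 0 * exp (- measure \<mu> B)"
    using poisson assms unfolding poisson_process_def by blast
  then show ?thesis by (simp add: num_points_eq_0)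
qed

text \<open>
  The Poisson weights add up to \<open>1\<close>, which leaves no mass for an infinite number of points.
\<close>

lemma AE_finite:
  assumes B: "B \<in> sets \<mu>" "emeasure \<mu> B < \<infinity>"
  shows "AE \<omega> in P. finite (\<omega> \<inter> B)"
proof -
  let ?N = "\<lambda>k. {\<omega> \<in> space P. num_points B \<omega> = of_nat k}"
  note num_points_measurable[OF B(1), measurable]
  have "(\<lambda>k. prob (?N k)) sums prob (\<Union>k. ?N k)"
    by (rule finite_measure_UNION) (auto simp: disjoint_family_on_def)
  moreover have "prob (?N k) = measure \<mu> B ^ k / fact k * exp (- measure \<mu> B)" for k
    using poisson B unfolding poisson_process_def by blast
  moreover have "(\<lambda>k. measure \<mu> B ^ k / fact k * exp (- measure \<mu> B)) sums
      (exp (measure \<mu> B) * exp (- measure \<mu> B))"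
    using exp_converges[of "measure \<mu> B"]
    by (intro sums_mult2) (simp add: divide_inverse mult.commute)
  ultimately have "prob (\<Union>k. ?N k) = exp (measure \<mu> B) * exp (- measure \<mu> B)"
    by (simp add: sums_iff)
  also have "\<dots> = 1"
    by (simp add: exp_minus)
  finally have "prob (\<Union>k. ?N k) = 1" .
  moreover have "(\<Union>k. ?N k) = {\<omega> \<in> space P. finite (\<omega> \<inter> B)}"
    by (auto simp: num_points_eq_of_nat)
  ultimately show ?thesis
    using prob_Collect_eq_1[OF finite_event[OF B(1)]] by simp
qed

lemma measurable_ident_void_space: "(\<lambda>\<omega>. \<omega>) \<in> P \<rightarrow>\<^sub>M void_space \<mu>"
  by (rule measurable_void_spaceI) (rule void_event)

text \<open>
  If \<open>B \<subseteq> E\<close> and \<open>C \<subseteq> F\<close> with \<open>E\<close> and \<open>F\<close> disjoint, then \<open>\<mu> (B \<union> C) = \<mu> B + \<mu> C\<close>, so the exponential in the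
  void probability factorises; the void events inside \<open>E\<close> and inside \<open>F\<close> are thus independent
  \<open>\<pi>\<close>-systems, and they generate the events that depend on the respective restrictions.
\<close>

lemma prob_restrict_indep:
  assumes EF: "E \<in> sets \<mu>" "F \<in> sets \<mu>" "E \<inter> F = {}"
    and a: "a \<in> sets (void_space \<mu>)" and b: "b \<in> sets (void_space \<mu>)"
  shows "prob {\<omega> \<in> space P. \<omega> \<inter> E \<in> a \<and> \<omega> \<inter> F \<in> b} =
    prob {\<omega> \<in> space P. \<omega> \<inter> E \<in> a} * prob {\<omega> \<in> space P. \<omega> \<inter> F \<in> b}"
proof -
  \<comment> \<open>void events inside \<open>E\<close>; they depend on the restriction of the configuration to \<open>E\<close> only\<close>
  define G where "G E = {{\<omega> \<in> space P. \<omega> \<inter> B = {}} |B. B \<in> sets \<mu> \<and> emeasure \<mu> B < \<infinity> \<and> B \<subseteq> E}" for E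
  have union_finite: "emeasure \<mu> (B \<union> B') < \<infinity>"
    if "B \<in> sets \<mu>" "emeasure \<mu> B < \<infinity>" "B' \<in> sets \<mu>" "emeasure \<mu> B' < \<infinity>" for B B'
    using emeasure_subadditive[of B \<mu> B'] that by (auto intro: le_less_trans)
  have "indep_set (G E) (G F)"
  proof (rule indep_setI)
    fix U V assume "U \<in> G E" "V \<in> G F"
    then obtain B C where B: "B \<in> sets \<mu>" "emeasure \<mu> B < \<infinity>" "B \<subseteq> E"
        and U: "U = {\<omega> \<in> space P. \<omega> \<inter> B = {}}"
        and C: "C \<in> sets \<mu>" "emeasure \<mu> C < \<infinity>" "C \<subseteq> F"
        and V: "V = {\<omega> \<in> space P. \<omega> \<inter> C = {}}"
      by (auto simp: G_def)
    have "U \<inter> V = {\<omega> \<in> space P. \<omega> \<inter> (B \<union> C) = {}}"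
      using U V by auto
    also have "prob \<dots> = exp (- measure \<mu> (B \<union> C))"
      using B C by (intro prob_void union_finite) auto
    also have "measure \<mu> (B \<union> C) = measure \<mu> B + measure \<mu> C"
      using B C EF by (intro measure_Union) auto
    finally show "prob (U \<inter> V) = prob U * prob V"
      using B C U V by (simp add: prob_void exp_add[symmetric])
  qed (auto simp: G_def intro: void_event)
  moreover have "Int_stable (G E)" for E
  proof (rule Int_stableI)
    fix U V assume "U \<in> G E" "V \<in> G E"
    then obtain B C where B: "B \<in> sets \<mu>" "emeasure \<mu> B < \<infinity>" "B \<subseteq> E"
        and U: "U = {\<omega> \<in> space P. \<omega> \<inter> B = {}}"
        and C: "C \<in> sets \<mu>" "emeasure \<mu> C < \<infinity>" "C \<subseteq> E"
        and V: "V = {\<omega> \<in> space P. \<omega> \<inter> C = {}}"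
      by (auto simp: G_def)
    have "U \<inter> V = {\<omega> \<in> space P. \<omega> \<inter> (B \<union> C) = {}}"
      using U V by auto
    moreover have "B \<union> C \<in> sets \<mu>" "emeasure \<mu> (B \<union> C) < \<infinity>" "B \<union> C \<subseteq> E"
      using B C union_finite by auto
    ultimately show "U \<inter> V \<in> G E"
      unfolding G_def by (intro CollectI exI[of _ "B \<union> C"] conjI)
  qed
  ultimately have indep: "indep_set (sigma_sets (space P) (G E)) (sigma_sets (space P) (G F))"
    by (intro indep_set_sigma_sets)
  have meas: "{\<omega> \<in> space P. \<omega> \<inter> E \<in> a} \<in> sigma_sets (space P) (G E)"
    if E: "E \<in> sets \<mu>" and a: "a \<in> sets (void_space \<mu>)" for E a
  proof -
    have "(\<lambda>\<omega>. \<omega> \<inter> E) \<in> sigma (space P) (G E) \<rightarrow>\<^sub>M void_space \<mu>"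
    proof (rule measurable_void_spaceI)
      fix B assume B: "B \<in> sets \<mu>" "emeasure \<mu> B < \<infinity>"
      have "emeasure \<mu> (E \<inter> B) < \<infinity>"
        using emeasure_mono[of "E \<inter> B" B \<mu>] B by (auto intro: le_less_trans)
      then have "{\<omega> \<in> space P. \<omega> \<inter> (E \<inter> B) = {}} \<in> G E"
        using E B unfolding G_def by (intro CollectI exI[of _ "E \<inter> B"]) auto
      then show "{\<omega> \<in> space (sigma (space P) (G E)). \<omega> \<inter> E \<inter> B = {}} \<in> sets (sigma (space P) (G E))"
        by (simp add: Int_assoc space_measure_of_conv) (intro in_measure_of, auto simp: G_def)
    qed
    from measurable_sets[OF this a] show ?thesis
      by (subst (asm) sets_measure_of)
         (auto simp: G_def vimage_def Int_def conj_commute space_measure_of_conv)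
  qed
  have "prob ({\<omega> \<in> space P. \<omega> \<inter> E \<in> a} \<inter> {\<omega> \<in> space P. \<omega> \<inter> F \<in> b}) =
      prob {\<omega> \<in> space P. \<omega> \<inter> E \<in> a} * prob {\<omega> \<in> space P. \<omega> \<inter> F \<in> b}"
    using indep_setD[OF indep meas[OF EF(1) a] meas[OF EF(2) b]] .
  moreover have "{\<omega> \<in> space P. \<omega> \<inter> E \<in> a} \<inter> {\<omega> \<in> space P. \<omega> \<inter> F \<in> b} =
      {\<omega> \<in> space P. \<omega> \<inter> E \<in> a \<and> \<omega> \<inter> F \<in> b}"
    by auto
  ultimately show ?thesis by simp
qed

text \<open>
  The image of \<open>\<omega>\<close> avoids \<open>B\<close> if and only if \<open>\<omega>\<close> avoids the preimage of \<open>B\<close>, which has the same intensity.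
  Thus the image process has the same void probabilities, and these determine its law.
\<close>

lemma prob_image_invariant:
  assumes f: "f \<in> \<mu> \<rightarrow>\<^sub>M \<mu>" and inv: "distr \<mu> \<mu> f = \<mu>" and sp: "space \<mu> = UNIV"
    and a: "a \<in> sets (void_space \<mu>)"
  shows "prob {\<omega> \<in> space P. f ` \<omega> \<in> a} = prob {\<omega> \<in> space P. \<omega> \<in> a}"
proof -
  let ?G = "{void B |B. B \<in> sets \<mu> \<and> emeasure \<mu> B < \<infinity>}"
  have im: "(\<lambda>\<omega>. f ` \<omega>) \<in> P \<rightarrow>\<^sub>M void_space \<mu>"
    using measurable_compose[OF measurable_ident_void_space measurable_image_config[OF f inv sp]] .
  have "distr P (void_space \<mu>) (\<lambda>\<omega>. f ` \<omega>) = distr P (void_space \<mu>) (\<lambda>\<omega>. \<omega>)"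
  proof (rule measure_eqI_generator_eq[where E = ?G and \<Omega> = UNIV and A = "\<lambda>_. UNIV"])
    show "Int_stable ?G"
    proof (rule Int_stableI)
      fix U V assume "U \<in> ?G" "V \<in> ?G"
      then obtain B C where B: "B \<in> sets \<mu>" "emeasure \<mu> B < \<infinity>" "U = void B"
          and C: "C \<in> sets \<mu>" "emeasure \<mu> C < \<infinity>" "V = void C"
        by auto
      have "emeasure \<mu> (B \<union> C) < \<infinity>"
        using emeasure_subadditive[of B \<mu> C] B C by (auto intro: le_less_trans)
      moreover have "U \<inter> V = void (B \<union> C)"
        using B C by (auto simp: void_def)
      moreover have "B \<union> C \<in> sets \<mu>"
        using B C by auto
      ultimately show "U \<inter> V \<in> ?G"
        by (intro CollectI exI[of _ "B \<union> C"] conjI)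
    qed
    show "emeasure (distr P (void_space \<mu>) (\<lambda>\<omega>. f ` \<omega>)) X =
        emeasure (distr P (void_space \<mu>) (\<lambda>\<omega>. \<omega>)) X" if "X \<in> ?G" for X
    proof -
      obtain B where B: "B \<in> sets \<mu>" "emeasure \<mu> B < \<infinity>" "X = void B"
        using \<open>X \<in> ?G\<close> by auto
      then have X: "X \<in> sets (void_space \<mu>)"
        by (simp add: void_in_void_space)
      have eq: "emeasure \<mu> (f -` B) = emeasure \<mu> B"
        using emeasure_distr[OF f B(1)] by (simp add: inv sp)
      then have meq: "measure \<mu> (f -` B) = measure \<mu> B"
        by (simp add: measure_def)
      have fB: "f -` B \<in> sets \<mu>"
        using measurable_sets[OF f B(1)] by (simp add: sp)
      have "(\<lambda>\<omega>. f ` \<omega>) -` X \<inter> space P = {\<omega> \<in> space P. \<omega> \<inter> f -` B = {}}"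
        using B by (auto simp: void_def)
      moreover have "(\<lambda>\<omega>. \<omega>) -` X \<inter> space P = {\<omega> \<in> space P. \<omega> \<inter> B = {}}"
        using B by (auto simp: void_def)
      ultimately show ?thesis
        using X B fB eq meq
        by (simp add: emeasure_distr[OF im] emeasure_distr[OF measurable_ident_void_space]
            emeasure_eq_measure prob_void)
    qed
    have "UNIV = void {}" by (simp add: void_def)
    then show "range (\<lambda>_. UNIV) \<subseteq> ?G" by auto
    interpret D: prob_space "distr P (void_space \<mu>) (\<lambda>\<omega>. f ` \<omega>)"
      by (rule prob_space_distr[OF im])
    show "emeasure (distr P (void_space \<mu>) (\<lambda>\<omega>. f ` \<omega>)) UNIV \<noteq> \<infinity>"
      by simp
  qed (auto simp: void_space_def)
  then have "measure (distr P (void_space \<mu>) (\<lambda>\<omega>. f ` \<omega>)) a = measure (distr P (void_space \<mu>) (\<lambda>\<omega>. \<omega>)) a"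
    by simp
  then show ?thesis
    using a by (simp add: measure_distr[OF im] measure_distr[OF measurable_ident_void_space]
        vimage_def Int_def conj_commute)
qed

end

section \<open>Intensity of points with a long reach\<close>

definition mark_space :: "(real \<times> real \<times> 2) measure"
  where "mark_space = lborel \<Otimes>\<^sub>M lborel \<Otimes>\<^sub>M count_space UNIV"

text \<open>
  The density of \<open>(r, \<xi>)\<close> summed over both orientations: an exponential law times a Pareto law.
\<close>

definition mark_density :: "real \<Rightarrow> real \<Rightarrow> real \<Rightarrow> real"
  where "mark_density \<alpha> r \<xi> =
    indicator {0..} r * indicator {1..} \<xi> * (\<alpha> * exp (- r) / \<xi> powr (\<alpha> + 1))"

lemma mark_density_nonneg: "0 \<le> \<alpha> \<Longrightarrow> 0 \<le> mark_density \<alpha> r \<xi>"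
  by (simp add: mark_density_def)

lemma measurable_mark_density [measurable (raw)]:
  assumes [measurable]: "f \<in> borel_measurable M" "g \<in> borel_measurable M"
  shows "(\<lambda>x. mark_density \<alpha> (f x) (g x)) \<in> borel_measurable M"
  unfolding mark_density_def by measurable

lemma point_space_eq: "point_space = lborel \<Otimes>\<^sub>M mark_space"
  by (simp add: point_space_def mark_space_def)

lemma sets_point_space [measurable_cong]:
  "sets point_space = sets (borel \<Otimes>\<^sub>M borel \<Otimes>\<^sub>M borel \<Otimes>\<^sub>M count_space UNIV)"
  unfolding point_space_def by (intro sets_pair_measure_cong sets_lborel refl)

lemma sets_mark_space [measurable_cong]:
  "sets mark_space = sets (borel \<Otimes>\<^sub>M borel \<Otimes>\<^sub>M count_space UNIV)"
  unfolding mark_space_def by (intro sets_pair_measure_cong sets_lborel refl)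

lemma space_point_space [simp]: "space point_space = UNIV"
  by (simp add: point_space_def space_pair_measure)

lemma intensity_eq:
  "intensity \<alpha> = density point_space (\<lambda>(x, r, \<xi>, \<sigma>). ennreal (mark_density \<alpha> r \<xi> / 2))"
  unfolding intensity_def
  by (intro arg_cong[where f = "density point_space"] ext) (auto simp: mark_density_def mult.commute)

lemma sets_intensity [simp, measurable_cong]: "sets (intensity \<alpha>) = sets point_space"
  by (simp add: intensity_def)

lemma space_intensity [simp]: "space (intensity \<alpha>) = UNIV"
  by (simp add: intensity_def)

interpretation count2: sigma_finite_measure "count_space (UNIV :: 2 set)"
  by (rule sigma_finite_measure_count_space_finite) simp

interpretation strength_mark: sigma_finite_measure
    "(lborel :: real measure) \<Otimes>\<^sub>M count_space (UNIV :: 2 set)"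
  by (intro sigma_finite_pair_measure sigma_finite_lborel count2.sigma_finite_measure_axioms)

interpretation mark_space: sigma_finite_measure mark_space
  unfolding mark_space_def
  by (intro sigma_finite_pair_measure sigma_finite_lborel strength_mark.sigma_finite_measure_axioms)

interpretation point_space: pair_sigma_finite "lborel :: plane measure" mark_space
  by unfold_locales

lemma sets_section:
  assumes "B \<in> sets point_space"
  shows "{x. (x, m) \<in> B} \<in> sets borel"
  using sets_Pair2[of B lborel mark_space m] assms
  by (simp only: point_space_eq vimage_def sets_lborel mem_Collect_eq)

text \<open>
  Integrating the location first is convenient twice: translation invariance is then inherited from the
  Lebesgue measure of the sections, and a geometric bound on the sections bounds the intensity.
\<close>

lemma emeasure_intensity:
  assumes B [measurable]: "B \<in> sets point_space"
  shows "emeasure (intensity \<alpha>) B =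
    (\<integral>\<^sup>+m. ennreal (mark_density \<alpha> (fst m) (fst (snd m)) / 2) * emeasure lborel {x. (x, m) \<in> B} \<partial>mark_space)"
proof -
  have "emeasure (intensity \<alpha>) B =
      (\<integral>\<^sup>+\<eta>. ennreal (mark_density \<alpha> (fst (snd \<eta>)) (fst (snd (snd \<eta>))) / 2) * indicator B \<eta> \<partial>point_space)"
    unfolding intensity_eq
    by (subst emeasure_density) (auto intro!: nn_integral_cong simp: split_beta')
  also have "\<dots> = (\<integral>\<^sup>+m. \<integral>\<^sup>+x. ennreal (mark_density \<alpha> (fst m) (fst (snd m)) / 2) * indicator B (x, m)
      \<partial>lborel \<partial>mark_space)"
    unfolding point_space_eq
    by (subst point_space.nn_integral_snd[symmetric])
       (auto simp flip: point_space_eq)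
  also have "\<dots> = (\<integral>\<^sup>+m. ennreal (mark_density \<alpha> (fst m) (fst (snd m)) / 2) * emeasure lborel {x. (x, m) \<in> B} \<partial>mark_space)"
  proof (intro nn_integral_cong)
    fix m
    note sets_section[OF B, of m, measurable]
    have "indicator B (x, m) = (indicator {x. (x, m) \<in> B} x :: ennreal)" for x
      by (simp add: indicator_def)
    then show "(\<integral>\<^sup>+x. ennreal (mark_density \<alpha> (fst m) (fst (snd m)) / 2) * indicator B (x, m) \<partial>lborel) =
        ennreal (mark_density \<alpha> (fst m) (fst (snd m)) / 2) * emeasure lborel {x. (x, m) \<in> B}"
      by (simp add: nn_integral_cmult)
  qed
  finally show ?thesis .
qed

definition translate :: "plane \<Rightarrow> point \<Rightarrow> point"
  where "translate z = (\<lambda>(x, m). (x + z, m))"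

lemma measurable_translate [measurable]: "translate z \<in> point_space \<rightarrow>\<^sub>M point_space"
  unfolding translate_def by measurable

lemma intensity_translate: "distr (intensity \<alpha>) (intensity \<alpha>) (translate z) = intensity \<alpha>"
proof (rule measure_eqI)
  fix B assume "B \<in> sets (distr (intensity \<alpha>) (intensity \<alpha>) (translate z))"
  then have B [measurable]: "B \<in> sets point_space" by simp
  have m: "translate z \<in> intensity \<alpha> \<rightarrow>\<^sub>M intensity \<alpha>"
    by measurable
  have tB: "translate z -` B \<in> sets point_space"
    using measurable_sets[OF measurable_translate B] by simp
  have "emeasure lborel {x. (x, m) \<in> translate z -` B} = emeasure lborel {x. (x, m) \<in> B}" for m
  proof -
    note sets_section[OF B, of m, measurable]
    have "emeasure lborel {x. (x, m) \<in> B} = emeasure (distr lborel borel ((+) z)) {x. (x, m) \<in> B}"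
      by (simp add: lborel_distr_plus)
    also have "\<dots> = emeasure lborel ((+) z -` {x. (x, m) \<in> B} \<inter> space lborel)"
      by (intro emeasure_distr) auto
    also have "(+) z -` {x. (x, m) \<in> B} \<inter> space lborel = {x. (x, m) \<in> translate z -` B}"
      by (auto simp: translate_def add.commute)
    finally show ?thesis ..
  qed
  then show "emeasure (distr (intensity \<alpha>) (intensity \<alpha>) (translate z)) B = emeasure (intensity \<alpha>) B"
    using emeasure_distr[OF m, of B] B by (simp add: emeasure_intensity[OF tB] emeasure_intensity[OF B])
qed simp

text \<open>
  The mean of \<open>(r \<xi> - d)\<^sup>+\<close>: the coercion \<open>ennreal\<close> sends negative reals to \<open>0\<close>.
\<close>

definition tail_integral :: "real \<Rightarrow> real \<Rightarrow> ennreal"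
  where "tail_integral \<alpha> d = (\<integral>\<^sup>+r. \<integral>\<^sup>+\<xi>. ennreal (mark_density \<alpha> r \<xi>) * ennreal (r * \<xi> - d) \<partial>lborel \<partial>lborel)"

text \<open>
  The two orientations carry weight \<open>1/2\<close> each, so a bound on the sections that is common to both
  orientations is integrated against the full density.
\<close>

lemma emeasure_intensity_le:
  assumes B: "B \<in> sets point_space" and "0 \<le> \<alpha>"
    and sec: "\<And>r \<xi> \<sigma>. 0 \<le> r \<Longrightarrow> 1 \<le> \<xi> \<Longrightarrow>
      emeasure lborel {x. (x, r, \<xi>, \<sigma>) \<in> B} \<le> ennreal K * ennreal (r * \<xi> - d)"
  shows "emeasure (intensity \<alpha>) B \<le> ennreal K * tail_integral \<alpha> d"
proof -
  let ?h = "\<lambda>r \<xi>. ennreal (mark_density \<alpha> r \<xi> / 2) * (ennreal K * ennreal (r * \<xi> - d))"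
  have "emeasure (intensity \<alpha>) B \<le> (\<integral>\<^sup>+m. ?h (fst m) (fst (snd m)) \<partial>mark_space)"
    unfolding emeasure_intensity[OF B]
  proof (intro nn_integral_mono)
    fix m :: "real \<times> real \<times> 2"
    show "ennreal (mark_density \<alpha> (fst m) (fst (snd m)) / 2) * emeasure lborel {x. (x, m) \<in> B} \<le>
        ?h (fst m) (fst (snd m))"
    proof (cases "0 \<le> fst m \<and> 1 \<le> fst (snd m)")
      case True
      then show ?thesis
        using sec[of "fst m" "fst (snd m)" "snd (snd m)"] by (intro mult_left_mono) auto
    qed (auto simp: mark_density_def)
  qed
  also have "\<dots> = (\<integral>\<^sup>+r. \<integral>\<^sup>+p. ?h r (fst p) \<partial>(lborel \<Otimes>\<^sub>M count_space (UNIV :: 2 set)) \<partial>lborel)"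
  proof -
    have "(\<lambda>m. ?h (fst m) (fst (snd m))) \<in> borel_measurable (lborel \<Otimes>\<^sub>M lborel \<Otimes>\<^sub>M count_space (UNIV :: 2 set))"
      unfolding mark_density_def by measurable
    from strength_mark.nn_integral_fst[OF this] show ?thesis
      by (simp add: mark_space_def)
  qed
  also have "\<dots> = (\<integral>\<^sup>+r. \<integral>\<^sup>+\<xi>. \<integral>\<^sup>+\<sigma>. ?h r \<xi> \<partial>count_space (UNIV :: 2 set) \<partial>lborel \<partial>lborel)"
  proof (intro nn_integral_cong)
    fix r
    show "(\<integral>\<^sup>+p. ?h r (fst p) \<partial>(lborel \<Otimes>\<^sub>M count_space (UNIV :: 2 set))) =
        (\<integral>\<^sup>+\<xi>. \<integral>\<^sup>+\<sigma>. ?h r \<xi> \<partial>count_space (UNIV :: 2 set) \<partial>lborel)"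
    proof -
      have "(\<lambda>p. ?h r (fst p)) \<in> borel_measurable (lborel \<Otimes>\<^sub>M count_space (UNIV :: 2 set))"
        by measurable
      from count2.nn_integral_fst[OF this] show ?thesis by simp
    qed
  qed
  also have "\<dots> = (\<integral>\<^sup>+r. \<integral>\<^sup>+\<xi>. ennreal K * (ennreal (mark_density \<alpha> r \<xi>) * ennreal (r * \<xi> - d)) \<partial>lborel \<partial>lborel)"
  proof (intro nn_integral_cong)
    fix r \<xi>
    have "(\<integral>\<^sup>+\<sigma>. ?h r \<xi> \<partial>count_space (UNIV :: 2 set)) = 2 * ?h r \<xi>"
      by (simp add: nn_integral_count_space_finite mult.commute)
    also have "\<dots> = 2 * ennreal (mark_density \<alpha> r \<xi> / 2) * (ennreal K * ennreal (r * \<xi> - d))"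
      by (simp only: mult.assoc)
    also have "2 * ennreal (mark_density \<alpha> r \<xi> / 2) = ennreal (mark_density \<alpha> r \<xi>)"
      using mark_density_nonneg[OF \<open>0 \<le> \<alpha>\<close>, of r \<xi>] ennreal_mult''[of "mark_density \<alpha> r \<xi> / 2" 2]
      by simp
    also have "\<dots> * (ennreal K * ennreal (r * \<xi> - d)) =
        ennreal K * (ennreal (mark_density \<alpha> r \<xi>) * ennreal (r * \<xi> - d))"
      by (rule mult.left_commute)
    finally show "(\<integral>\<^sup>+\<sigma>. ?h r \<xi> \<partial>count_space (UNIV :: 2 set)) =
        ennreal K * (ennreal (mark_density \<alpha> r \<xi>) * ennreal (r * \<xi> - d))" .
  qed
  also have "\<dots> = ennreal K * tail_integral \<alpha> d"
    unfolding tail_integral_def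
    by (simp add: nn_integral_cmult)
  finally show ?thesis .
qed

lemma nn_integral_powr_atLeast:
  assumes "1 < \<alpha>" "0 < s"
  shows "(\<integral>\<^sup>+\<xi>. ennreal (\<xi> powr - \<alpha>) * indicator {s..} \<xi> \<partial>lborel) =
    ennreal (s powr (1 - \<alpha>) / (\<alpha> - 1))"
proof -
  define c where "c = - 1 / (\<alpha> - 1)"
  have c: "c * (1 - \<alpha>) = 1"
    using assms by (simp add: c_def field_simps)
  have "(\<integral>\<^sup>+\<xi>. ennreal (\<xi> powr - \<alpha>) * indicator {s..} \<xi> \<partial>lborel) =
      ennreal (0 - c * s powr (1 - \<alpha>))"
  proof (rule nn_integral_FTC_atLeast)
    show "DERIV (\<lambda>\<xi>. c * \<xi> powr (1 - \<alpha>)) x :> x powr - \<alpha>" if "s \<le> x" for x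
    proof -
      have "DERIV (\<lambda>\<xi>. c * \<xi> powr (1 - \<alpha>)) x :> c * ((1 - \<alpha>) * x powr (1 - \<alpha> - 1))"
        using assms that by (intro DERIV_cmult has_real_derivative_powr) auto
      then show ?thesis
        by (simp add: c flip: mult.assoc)
    qed
    have "((\<lambda>\<xi>. \<xi> powr (1 - \<alpha>)) \<longlongrightarrow> 0) at_top"
      using assms by (intro tendsto_neg_powr filterlim_ident) auto
    then show "((\<lambda>\<xi>. c * \<xi> powr (1 - \<alpha>)) \<longlongrightarrow> 0) at_top"
      by (rule tendsto_mult_right_zero)
  qed auto
  then show ?thesis by (simp add: c_def)
qed

lemma nn_integral_Gamma:
  assumes "0 < s"
  shows "(\<integral>\<^sup>+r. ennreal (indicator {0..} r * (r powr (s - 1) * exp (- r))) \<partial>lborel) = ennreal (Gamma s)"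
  using Gamma_conv_nn_integral_real[OF assms] by (simp add: exp_minus divide_inverse mult_ac)

text \<open>
  The integrand vanishes unless \<open>\<xi> \<ge> d / r\<close>, and there \<open>r \<xi> - d \<le> r \<xi>\<close>. Extending the range of \<open>\<xi>\<close> from
  \<open>{max 1 (d / r)..}\<close> to \<open>{d / r..}\<close> leaves a power integral that is proportional to \<open>r\<^sup>\<alpha> d\<^sup>1\<^sup>-\<^sup>\<alpha>\<close>, and the
  integral over \<open>r\<close> is then a Gamma integral.
\<close>

lemma tail_integral_le:
  assumes \<alpha>: "1 < \<alpha>" and d: "0 < d"
  shows "tail_integral \<alpha> d \<le> ennreal (\<alpha> / (\<alpha> - 1) * Gamma (\<alpha> + 1) * d powr (1 - \<alpha>))"
proof -
  have inner: "(\<integral>\<^sup>+\<xi>. ennreal (mark_density \<alpha> r \<xi>) * ennreal (r * \<xi> - d) \<partial>lborel) \<le>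
      ennreal (\<alpha> / (\<alpha> - 1) * d powr (1 - \<alpha>)) * ennreal (indicator {0..} r * (r powr \<alpha> * exp (- r)))" for r
  proof (cases "0 < r")
    case False
    then have "ennreal (mark_density \<alpha> r \<xi>) * ennreal (r * \<xi> - d) = 0" for \<xi>
      using d by (auto simp: mark_density_def indicator_def ennreal_neg)
    then have "(\<integral>\<^sup>+\<xi>. ennreal (mark_density \<alpha> r \<xi>) * ennreal (r * \<xi> - d) \<partial>lborel) = 0"
      by (intro nn_integral_zero' AE_I2)
    then show ?thesis by (simp only: zero_le)
  next
    case True
    have "(\<integral>\<^sup>+\<xi>. ennreal (mark_density \<alpha> r \<xi>) * ennreal (r * \<xi> - d) \<partial>lborel) \<le>
        (\<integral>\<^sup>+\<xi>. ennreal (\<alpha> * exp (- r) * r) * (ennreal (\<xi> powr - \<alpha>) * indicator {d / r..} \<xi>) \<partial>lborel)"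
    proof (intro nn_integral_mono)
      fix \<xi> :: real
      show "ennreal (mark_density \<alpha> r \<xi>) * ennreal (r * \<xi> - d) \<le>
          ennreal (\<alpha> * exp (- r) * r) * (ennreal (\<xi> powr - \<alpha>) * indicator {d / r..} \<xi>)"
      proof (cases "1 \<le> \<xi> \<and> d \<le> r * \<xi>")
        case True
        then have "d / r \<le> \<xi>"
          using \<open>0 < r\<close> by (simp add: field_simps)
        have "mark_density \<alpha> r \<xi> * (r * \<xi> - d) \<le> mark_density \<alpha> r \<xi> * (r * \<xi>)"
          using d \<alpha> by (intro mult_left_mono mark_density_nonneg) auto
        also have "\<dots> = \<alpha> * exp (- r) * r * \<xi> powr - \<alpha>"
          using True \<open>0 < r\<close> by (simp add: mark_density_def powr_add powr_minus field_simps)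
        finally show ?thesis
          using True \<open>d / r \<le> \<xi>\<close> \<open>0 < r\<close> \<alpha>
          by (simp add: ennreal_mult''[symmetric] mark_density_nonneg ennreal_leI)
      next
        case False
        then have "mark_density \<alpha> r \<xi> = 0 \<or> r * \<xi> - d \<le> 0"
          by (auto simp: mark_density_def)
        then show ?thesis
          by (auto simp: ennreal_neg)
      qed
    qed
    also have "\<dots> = ennreal (\<alpha> * exp (- r) * r) * ennreal ((d / r) powr (1 - \<alpha>) / (\<alpha> - 1))"
      using nn_integral_powr_atLeast[of \<alpha> "d / r"] \<alpha> d True by (simp add: nn_integral_cmult)
    also have "\<dots> = ennreal (\<alpha> * exp (- r) * r * ((d / r) powr (1 - \<alpha>) / (\<alpha> - 1)))"
      using \<alpha> True by (subst ennreal_mult'') auto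
    also have "\<alpha> * exp (- r) * r * ((d / r) powr (1 - \<alpha>) / (\<alpha> - 1)) =
        (\<alpha> / (\<alpha> - 1) * d powr (1 - \<alpha>)) * (r powr \<alpha> * exp (- r))"
      using \<alpha> True d by (simp add: powr_divide powr_diff field_simps)
    also have "ennreal \<dots> = ennreal (\<alpha> / (\<alpha> - 1) * d powr (1 - \<alpha>)) * ennreal (r powr \<alpha> * exp (- r))"
      by (rule ennreal_mult'') simp
    finally show ?thesis
      using True by simp
  qed
  have "tail_integral \<alpha> d \<le> (\<integral>\<^sup>+r. ennreal (\<alpha> / (\<alpha> - 1) * d powr (1 - \<alpha>)) *
      ennreal (indicator {0..} r * (r powr \<alpha> * exp (- r))) \<partial>lborel)"
    unfolding tail_integral_def by (intro nn_integral_mono inner)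
  also have "\<dots> = ennreal (\<alpha> / (\<alpha> - 1) * d powr (1 - \<alpha>)) * ennreal (Gamma (\<alpha> + 1))"
    using nn_integral_Gamma[of "\<alpha> + 1"] \<alpha> by (simp add: nn_integral_cmult)
  also have "\<dots> = ennreal (\<alpha> / (\<alpha> - 1) * Gamma (\<alpha> + 1) * d powr (1 - \<alpha>))"
    using \<alpha> by (simp add: ennreal_mult''[symmetric] mult_ac Gamma_real_pos less_imp_le)
  finally show ?thesis .
qed

text \<open>
  Since \<open>\<xi> \<ge> 1\<close>, the integrand is at most \<open>\<xi> (r + |d|)\<close>, and \<open>\<xi>\<close> has a finite mean for \<open>\<alpha> > 1\<close>. This
  covers the negative \<open>d\<close> that occur for windows close to each other.
\<close>

lemma tail_integral_finite:
  assumes \<alpha>: "1 < \<alpha>"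
  shows "tail_integral \<alpha> d < \<infinity>"
proof -
  have inner: "(\<integral>\<^sup>+\<xi>. ennreal (mark_density \<alpha> r \<xi>) * ennreal (r * \<xi> - d) \<partial>lborel) \<le>
      ennreal (\<alpha> / (\<alpha> - 1)) * (ennreal (indicator {0..} r * (r powr (2 - 1) * exp (- r))) +
        ennreal \<bar>d\<bar> * ennreal (indicator {0..} r * (r powr (1 - 1) * exp (- r))))"
    if "r \<noteq> 0" for r
  proof (cases "0 \<le> r")
    case False
    then have "ennreal (mark_density \<alpha> r \<xi>) * ennreal (r * \<xi> - d) = 0" for \<xi>
      by (auto simp: mark_density_def indicator_def)
    then have "(\<integral>\<^sup>+\<xi>. ennreal (mark_density \<alpha> r \<xi>) * ennreal (r * \<xi> - d) \<partial>lborel) = 0"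
      by (intro nn_integral_zero' AE_I2)
    then show ?thesis by (simp only: zero_le)
  next
    case True
    have "(\<integral>\<^sup>+\<xi>. ennreal (mark_density \<alpha> r \<xi>) * ennreal (r * \<xi> - d) \<partial>lborel) \<le>
        (\<integral>\<^sup>+\<xi>. ennreal (\<alpha> * exp (- r) * (r + \<bar>d\<bar>)) * (ennreal (\<xi> powr - \<alpha>) * indicator {1..} \<xi>) \<partial>lborel)"
    proof (intro nn_integral_mono)
      fix \<xi> :: real
      show "ennreal (mark_density \<alpha> r \<xi>) * ennreal (r * \<xi> - d) \<le>
          ennreal (\<alpha> * exp (- r) * (r + \<bar>d\<bar>)) * (ennreal (\<xi> powr - \<alpha>) * indicator {1..} \<xi>)"
      proof (cases "1 \<le> \<xi>")
        case \<xi>: True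
        have "\<bar>d\<bar> * 1 \<le> \<bar>d\<bar> * \<xi>"
          using \<xi> by (intro mult_left_mono) auto
        then have "r * \<xi> - d \<le> (r + \<bar>d\<bar>) * \<xi>"
          by (simp add: distrib_right)
        then have "mark_density \<alpha> r \<xi> * (r * \<xi> - d) \<le> mark_density \<alpha> r \<xi> * ((r + \<bar>d\<bar>) * \<xi>)"
          using \<alpha> by (intro mult_left_mono mark_density_nonneg) auto
        also have "\<dots> = \<alpha> * exp (- r) * (r + \<bar>d\<bar>) * \<xi> powr - \<alpha>"
          using \<xi> True by (simp add: mark_density_def powr_add powr_minus field_simps)
        finally show ?thesis
          using True \<xi> \<alpha>
          by (simp add: ennreal_mult'[symmetric] mark_density_nonneg ennreal_leI)
      qed (simp add: mark_density_def)
    qed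
    also have "\<dots> = ennreal (\<alpha> * exp (- r) * (r + \<bar>d\<bar>)) * ennreal (1 / (\<alpha> - 1))"
      using nn_integral_powr_atLeast[of \<alpha> 1] \<alpha> by (simp add: nn_integral_cmult)
    also have "\<dots> = ennreal (\<alpha> * exp (- r) * (r + \<bar>d\<bar>) * (1 / (\<alpha> - 1)))"
      using \<alpha> True by (subst ennreal_mult'') auto
    also have "\<alpha> * exp (- r) * (r + \<bar>d\<bar>) * (1 / (\<alpha> - 1)) =
        \<alpha> / (\<alpha> - 1) * (r powr (2 - 1) * exp (- r) + \<bar>d\<bar> * (r powr (1 - 1) * exp (- r)))"
      using \<alpha> True \<open>r \<noteq> 0\<close> by (simp add: field_simps)
    also have "ennreal \<dots> = ennreal (\<alpha> / (\<alpha> - 1)) *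
        (ennreal (r powr (2 - 1) * exp (- r)) + ennreal \<bar>d\<bar> * ennreal (r powr (1 - 1) * exp (- r)))"
      using \<alpha> True by (simp only: ennreal_mult'[symmetric] ennreal_plus[symmetric] abs_ge_zero
          divide_nonneg_pos mult_nonneg_nonneg powr_ge_zero exp_ge_zero)
    finally show ?thesis
      using True by simp
  qed
  have "tail_integral \<alpha> d \<le> (\<integral>\<^sup>+r. ennreal (\<alpha> / (\<alpha> - 1)) * (ennreal (indicator {0..} r * (r powr (2 - 1) * exp (- r))) +
        ennreal \<bar>d\<bar> * ennreal (indicator {0..} r * (r powr (1 - 1) * exp (- r)))) \<partial>lborel)"
    unfolding tail_integral_def
    by (intro nn_integral_mono_AE eventually_mono[OF AE_lborel_singleton[of 0]] inner)
  also have "\<dots> = ennreal (\<alpha> / (\<alpha> - 1)) * (ennreal (Gamma 2) + ennreal \<bar>d\<bar> * ennreal (Gamma 1))"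
    using nn_integral_Gamma[of 2] nn_integral_Gamma[of 1]
    by (simp add: nn_integral_cmult nn_integral_add)
  also have "\<dots> < \<infinity>"
    by (simp add: ennreal_mult_less_top)
  finally show ?thesis .
qed

section \<open>Points that influence a given window\<close>

text \<open>
  The square of half side \<open>M\<close> centred at \<open>- z\<close>: the field shifted by \<open>z\<close> sees on \<open>square M\<close> what the field
  itself shows on \<open>window (- z) M\<close>.
\<close>

definition window :: "plane \<Rightarrow> real \<Rightarrow> plane set"
  where "window z M = {- M - fst z..M - fst z} \<times> {- M - snd z..M - snd z}"

definition meeting :: "plane set \<Rightarrow> point set"
  where "meeting K = {\<eta>. influence \<eta> \<inter> K \<noteq> {}}"

lemma meeting_mono: "K \<subseteq> L \<Longrightarrow> meeting K \<subseteq> meeting L"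
  by (auto simp: meeting_def)

lemma influence_iff:
  "y \<in> influence ((x1, x2), r, \<xi>, \<sigma>) \<longleftrightarrow>
    (if \<sigma> = 1 then x1 \<le> fst y \<and> fst y \<le> x1 + r * \<xi> \<and> x2 \<le> snd y \<and> snd y \<le> x2 + 1
     else x1 \<le> fst y \<and> fst y \<le> x1 + 1 \<and> x2 \<le> snd y \<and> snd y \<le> x2 + r * \<xi>)"
  by (cases y) (auto simp: influence_def)

lemma Icc_Int_Icc_nonempty: "{a..b} \<inter> {c..d} \<noteq> {} \<longleftrightarrow> max a c \<le> min b d"
  for a b c d :: real
  by (subst Int_atLeastAtMost) auto

lemma measurable_point_coordinates [measurable]:
  "(\<lambda>\<eta>. fst (location \<eta>)) \<in> borel_measurable point_space"
  "(\<lambda>\<eta>. snd (location \<eta>)) \<in> borel_measurable point_space"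
  "(\<lambda>\<eta>. fst (snd \<eta>)) \<in> borel_measurable point_space"
  "strength \<in> borel_measurable point_space"
  "orientation \<in> point_space \<rightarrow>\<^sub>M count_space UNIV"
proof -
  have "location \<in> point_space \<rightarrow>\<^sub>M (borel :: plane measure)"
    unfolding point_space_def by measurable
  moreover have "fst \<in> (borel :: plane measure) \<rightarrow>\<^sub>M (borel :: real measure)"
      "snd \<in> (borel :: plane measure) \<rightarrow>\<^sub>M (borel :: real measure)"
    by (intro borel_measurable_continuous_onI continuous_intros)+
  ultimately show "(\<lambda>\<eta>. fst (location \<eta>)) \<in> borel_measurable point_space"
      "(\<lambda>\<eta>. snd (location \<eta>)) \<in> borel_measurable point_space"
    by (auto intro: measurable_compose)
qed (unfold point_space_def, measurable)

lemma meeting_box: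
  "((x1, x2), r, \<xi>, \<sigma>) \<in> meeting ({a1..b1} \<times> {a2..b2}) \<longleftrightarrow>
    (if \<sigma> = 1 then max x1 a1 \<le> min (x1 + r * \<xi>) b1 \<and> max x2 a2 \<le> min (x2 + 1) b2
     else max x1 a1 \<le> min (x1 + 1) b1 \<and> max x2 a2 \<le> min (x2 + r * \<xi>) b2)"
  unfolding meeting_def influence_def mem_Collect_eq
  by (simp only: if_distrib[where f = "\<lambda>A. A \<inter> _ \<noteq> {}"] Times_Int_Times Times_empty de_Morgan_disj
      Icc_Int_Icc_nonempty prod.case)

lemma meeting_box_measurable [measurable]: "meeting ({a1..b1} \<times> {a2..b2}) \<in> sets point_space"
proof -
  have "meeting ({a1..b1} \<times> {a2..b2}) = {\<eta> \<in> space point_space.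
      if orientation \<eta> = 1
      then max (fst (location \<eta>)) a1 \<le> min (fst (location \<eta>) + fst (snd \<eta>) * strength \<eta>) b1 \<and>
        max (snd (location \<eta>)) a2 \<le> min (snd (location \<eta>) + 1) b2
      else max (fst (location \<eta>)) a1 \<le> min (fst (location \<eta>) + 1) b1 \<and>
        max (snd (location \<eta>)) a2 \<le> min (snd (location \<eta>) + fst (snd \<eta>) * strength \<eta>) b2}"
    by (intro set_eqI) (clarsimp simp only: mem_Collect_eq split_paired_all meeting_box
        fst_conv snd_conv space_point_space UNIV_I simp_thms)
  also have "\<dots> \<in> sets point_space"
    by measurable
  finally show ?thesis .
qed

lemma meeting_window_measurable [measurable]: "meeting (window z M) \<in> sets point_space"
  unfolding window_def by (rule meeting_box_measurable)

text \<open>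
  Consider a point of orientation \<open>1\<close> that meets both windows. Its domain has height \<open>1\<close>, so the vertical
  offset \<open>snd z\<close> is at most \<open>2 M + 1\<close> and its second coordinate ranges over an interval of length \<open>2 M + 1\<close>. Its
  first coordinate has to lie left of the right edges of both windows while the right end of its domain
  is right of both left edges, which leaves an interval of length \<open>r \<xi> + 2 M - |fst z|\<close>. As
  \<open>|fst z| \<ge> |z|\<^sub>1 - (2 M + 1)\<close>, this is at most \<open>r \<xi> - (|z|\<^sub>1 - (4 M + 1))\<close>. Orientation \<open>2\<close> is symmetric.
\<close>

lemma emeasure_meeting_two_windows:
  assumes \<alpha>: "1 < \<alpha>" and M: "0 \<le> M"
  shows "emeasure (intensity \<alpha>) (meeting (window 0 M) \<inter> meeting (window z M)) \<le>
    ennreal (2 * M + 1) * tail_integral \<alpha> (l1_norm z - (4 * M + 1))"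
proof (rule emeasure_intensity_le)
  show "meeting (window 0 M) \<inter> meeting (window z M) \<in> sets point_space"
    by measurable
  show "0 \<le> \<alpha>" using \<alpha> by simp
  fix r \<xi> :: real and \<sigma> :: 2
  define S where "S = {x. (x, r, \<xi>, \<sigma>) \<in> meeting (window 0 M) \<inter> meeting (window z M)}"
  have *: "emeasure lborel S \<le> ennreal (2 * M + 1) * ennreal (r * \<xi> - (l1_norm z - (4 * M + 1)))"
    if S: "S \<subseteq> {a1..b1} \<times> {a2..b2}"
      and len: "S \<noteq> {} \<Longrightarrow> b1 - a1 \<le> p \<and> b2 - a2 \<le> q"
      and pq: "(p = 2 * M + 1 \<and> q = r * \<xi> - (l1_norm z - (4 * M + 1))) \<or>
        (q = 2 * M + 1 \<and> p = r * \<xi> - (l1_norm z - (4 * M + 1)))" for a1 b1 a2 b2 p q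
  proof (cases "S = {}")
    case False
    have "emeasure lborel S \<le> emeasure lborel ({a1..b1} \<times> {a2..b2})"
      using S by (intro emeasure_mono) (auto simp flip: lborel_prod)
    also have "\<dots> = emeasure lborel {a1..b1} * emeasure lborel {a2..b2}"
      by (subst lborel_prod[symmetric], rule lborel.emeasure_pair_measure_Times) auto
    also have "\<dots> \<le> ennreal p * ennreal q"
      using len[OF False] by (intro mult_mono) (auto simp: emeasure_lborel_Icc_eq intro!: ennreal_leI)
    finally show ?thesis
      using pq by (auto simp: mult.commute)
  qed simp
  have S_iff: "(x1, x2) \<in> S \<longleftrightarrow>
      ((x1, x2), r, \<xi>, \<sigma>) \<in> meeting ({- M..M} \<times> {- M..M}) \<and>
      ((x1, x2), r, \<xi>, \<sigma>) \<in> meeting ({- M - fst z..M - fst z} \<times> {- M - snd z..M - snd z})" for x1 x2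
    by (simp add: S_def window_def)
  show "emeasure lborel {x. (x, r, \<xi>, \<sigma>) \<in> meeting (window 0 M) \<inter> meeting (window z M)}
      \<le> ennreal (2 * M + 1) * ennreal (r * \<xi> - (l1_norm z - (4 * M + 1)))"
    unfolding S_def[symmetric]
  proof (cases "\<sigma> = 1")
    case True
    show "emeasure lborel S \<le> ennreal (2 * M + 1) * ennreal (r * \<xi> - (l1_norm z - (4 * M + 1)))"
    proof (rule *[where p = "r * \<xi> - (l1_norm z - (4 * M + 1))" and q = "2 * M + 1"])
      show "S \<subseteq> {- M - min 0 (fst z) - r * \<xi>..M - max 0 (fst z)} \<times> {- M - 1..M}"
        using True by (auto simp: S_iff meeting_box)
      assume "S \<noteq> {}"
      then obtain x1 x2 where "(x1, x2) \<in> S" by (metis ex_in_conv surj_pair)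
      then have "\<bar>snd z\<bar> \<le> 2 * M + 1"
        using True by (auto simp: S_iff meeting_box)
      then show "M - max 0 (fst z) - (- M - min 0 (fst z) - r * \<xi>) \<le> r * \<xi> - (l1_norm z - (4 * M + 1)) \<and>
          M - (- M - 1) \<le> 2 * M + 1"
        by (auto simp: l1_norm_def)
    qed simp
  next
    case False
    show "emeasure lborel S \<le> ennreal (2 * M + 1) * ennreal (r * \<xi> - (l1_norm z - (4 * M + 1)))"
    proof (rule *[where q = "r * \<xi> - (l1_norm z - (4 * M + 1))" and p = "2 * M + 1"])
      show "S \<subseteq> {- M - 1..M} \<times> {- M - min 0 (snd z) - r * \<xi>..M - max 0 (snd z)}"
        using False by (auto simp: S_iff meeting_box)
      assume "S \<noteq> {}"
      then obtain x1 x2 where "(x1, x2) \<in> S" by (metis ex_in_conv surj_pair)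
      then have "\<bar>fst z\<bar> \<le> 2 * M + 1"
        using False by (auto simp: S_iff meeting_box)
      then show "M - (- M - 1) \<le> 2 * M + 1 \<and>
          M - max 0 (snd z) - (- M - min 0 (snd z) - r * \<xi>) \<le> r * \<xi> - (l1_norm z - (4 * M + 1))"
        by (auto simp: l1_norm_def)
    qed simp
  qed
qed

lemma bounded_subset_window:
  assumes "bounded K"
  obtains n :: nat where "K \<subseteq> window 0 (real n)"
proof -
  obtain B where B: "\<And>x. x \<in> K \<Longrightarrow> norm x \<le> B"
    using assms by (auto simp: bounded_iff)
  obtain n where n: "B \<le> real n"
    using real_arch_simple by blast
  have "K \<subseteq> window 0 (real n)"
  proof
    fix x assume "x \<in> K"
    then have "norm x \<le> real n" using B n order_trans by blast
    then show "x \<in> window 0 (real n)"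
      using norm_fst_le[of "fst x" "snd x"] norm_snd_le[of "snd x" "fst x"]
      by (cases x) (auto simp: window_def abs_le_iff)
  qed
  then show ?thesis by (rule that)
qed

text \<open>
  Both windows coincide for \<open>z = 0\<close>, so this is a case of the bound for two windows.
\<close>

lemma emeasure_meeting_finite:
  assumes "1 < \<alpha>" "bounded K"
  shows "emeasure (intensity \<alpha>) (meeting K) < \<infinity>"
proof -
  obtain n where n: "K \<subseteq> window 0 (real n)"
    using bounded_subset_window[OF assms(2)] .
  have "emeasure (intensity \<alpha>) (meeting K) \<le> emeasure (intensity \<alpha>) (meeting (window 0 (real n)))"
    using meeting_mono[OF n] by (intro emeasure_mono) auto
  also have "\<dots> < \<infinity>"
    using emeasure_meeting_two_windows[OF assms(1), of "real n" 0] tail_integral_finite[OF assms(1)]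
    by (auto simp: ennreal_mult_less_top intro: le_less_trans)
  finally show ?thesis .
qed

text \<open>
  The threshold on \<open>z\<close> is chosen such that the distance \<open>|z|\<^sub>1 - (4 M + 1)\<close> to be bridged is at least
  \<open>|z|\<^sub>1 / 2\<close>.
\<close>

lemma measure_meeting_two_windows:
  assumes \<alpha>: "1 < \<alpha>" and M: "0 \<le> M" and z: "8 * M + 2 \<le> l1_norm z"
  shows "measure (intensity \<alpha>) (meeting (window 0 M) \<inter> meeting (window z M)) \<le>
    (2 * M + 1) * (\<alpha> / (\<alpha> - 1) * Gamma (\<alpha> + 1) * 2 powr (\<alpha> - 1)) * l1_norm z powr (1 - \<alpha>)"
proof -
  let ?d = "l1_norm z - (4 * M + 1)"
  let ?c = "\<alpha> / (\<alpha> - 1) * Gamma (\<alpha> + 1)"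
  have c: "0 \<le> ?c"
    using \<alpha> by (simp add: Gamma_real_pos less_imp_le)
  have d: "0 < l1_norm z" "l1_norm z / 2 \<le> ?d"
    using z M by auto
  have "emeasure (intensity \<alpha>) (meeting (window 0 M) \<inter> meeting (window z M)) \<le>
      ennreal (2 * M + 1) * ennreal (?c * ?d powr (1 - \<alpha>))"
    using emeasure_meeting_two_windows[OF \<alpha> M, of z] tail_integral_le[OF \<alpha>, of ?d] d
    by (meson half_gt_zero less_le_trans mult_left_mono order_trans zero_le)
  also have "\<dots> = ennreal ((2 * M + 1) * (?c * ?d powr (1 - \<alpha>)))"
    using M c by (intro ennreal_mult'[symmetric]) auto
  finally have "measure (intensity \<alpha>) (meeting (window 0 M) \<inter> meeting (window z M)) \<le>
      (2 * M + 1) * (?c * ?d powr (1 - \<alpha>))"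
    unfolding measure_def
    using M by (intro enn2real_leI mult_nonneg_nonneg[OF _ mult_nonneg_nonneg[OF c]]) auto
  also have "\<dots> \<le> (2 * M + 1) * (?c * (l1_norm z / 2) powr (1 - \<alpha>))"
    using M c d \<alpha> by (intro mult_left_mono powr_mono2') auto
  also have "(l1_norm z / 2) powr (1 - \<alpha>) = 2 powr (\<alpha> - 1) * l1_norm z powr (1 - \<alpha>)"
    using d by (simp add: powr_divide powr_diff field_simps)
  finally show ?thesis by (simp add: mult_ac)
qed

section \<open>The field as a function of void events\<close>

text \<open>
  On configurations with \<open>finite_influence\<close> this says that \<open>y\<close> lies in the influence of a point of orientation
  \<open>\<sigma>\<close> whose strength exceeds \<open>q\<close>. It is phrased through rational boxes around \<open>y\<close>, each of which has to be
  met by such an influence, so that it is a countable combination of void events in which the location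
  \<open>y\<close> only selects the boxes. This makes it jointly measurable in \<open>\<omega>\<close> and \<open>y\<close>.
\<close>

definition covered :: "2 \<Rightarrow> rat \<Rightarrow> config \<Rightarrow> plane \<Rightarrow> bool"
  where "covered \<sigma> q \<omega> y \<longleftrightarrow> (\<forall>a1 b1 a2 b2 :: rat.
    of_rat a1 < fst y \<and> fst y < of_rat b1 \<and> of_rat a2 < snd y \<and> snd y < of_rat b2 \<longrightarrow>
    \<omega> \<inter> {\<eta> \<in> meeting ({of_rat a1..of_rat b1} \<times> {of_rat a2..of_rat b2}).
      orientation \<eta> = \<sigma> \<and> of_rat q < strength \<eta>} \<noteq> {})"

text \<open>
  The strongest influence at \<open>y\<close> has orientation \<open>1\<close> if and only if a rational threshold \<open>q\<close> separates the
  strongest influences of the two orientations, that of orientation \<open>1\<close> being above \<open>q\<close>.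
\<close>

definition threshold_field :: "config \<Rightarrow> plane \<Rightarrow> plane"
  where "threshold_field \<omega> y =
    (if \<exists>q. covered 1 q \<omega> y \<and> \<not> covered 2 q \<omega> y then unit_vec 1
     else if \<exists>q. covered 2 q \<omega> y \<and> \<not> covered 1 q \<omega> y then unit_vec 2
     else (1 / 2) *\<^sub>R (unit_vec 1 + unit_vec 2))"

lemma closed_influence: "closed (influence \<eta>)"
  by (cases \<eta>) (auto simp: influence_def intro!: closed_Times)

lemma rat_interval:
  fixes t :: real
  assumes "open A" "t \<in> A"
  obtains a b :: rat where "of_rat a < t" "t < of_rat b" "{of_rat a..of_rat b} \<subseteq> A"
proof -
  obtain e where e: "0 < e" "\<And>s. \<bar>s - t\<bar> < e \<Longrightarrow> s \<in> A"
    using assms by (auto simp: open_real)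
  obtain a b :: rat where "t - e < of_rat a" "of_rat a < t" "t < of_rat b" "of_rat b < t + e"
    using of_rat_dense[of "t - e" t] of_rat_dense[of t "t + e"] e(1) by auto
  then show ?thesis
    using e(2) by (intro that[of a b]) (auto simp: abs_less_iff)
qed

lemma rat_box:
  fixes y :: plane
  assumes "open V" "y \<in> V"
  obtains a1 b1 a2 b2 :: rat where "of_rat a1 < fst y" "fst y < of_rat b1"
    "of_rat a2 < snd y" "snd y < of_rat b2" "{of_rat a1..of_rat b1} \<times> {of_rat a2..of_rat b2} \<subseteq> V"
proof -
  obtain A B where AB: "open A" "open B" "y \<in> A \<times> B" "A \<times> B \<subseteq> V"
    using assms by (rule open_prod_elim)
  then have "fst y \<in> A" "snd y \<in> B"
    by auto
  obtain a1 b1 where 1: "of_rat a1 < fst y" "fst y < of_rat b1" "{of_rat a1..of_rat b1} \<subseteq> A"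
    by (rule rat_interval[OF \<open>open A\<close> \<open>fst y \<in> A\<close>])
  obtain a2 b2 where 2: "of_rat a2 < snd y" "snd y < of_rat b2" "{of_rat a2..of_rat b2} \<subseteq> B"
    by (rule rat_interval[OF \<open>open B\<close> \<open>snd y \<in> B\<close>])
  have "{of_rat a1..of_rat b1} \<times> {of_rat a2..of_rat b2} \<subseteq> V"
    using 1(3) 2(3) AB(4) by blast
  with 1 2 show ?thesis
    by (intro that) auto
qed

text \<open>
  If no such point influenced \<open>y\<close>, the finitely many candidates near \<open>y\<close> would have closed influences
  avoiding \<open>y\<close>, and a small box around \<open>y\<close> would avoid them all.
\<close>

lemma covered_iff:
  assumes fin: "finite_influence \<omega>"
  shows "covered \<sigma> q \<omega> y \<longleftrightarrow> (\<exists>\<eta>\<in>\<omega>. y \<in> influence \<eta> \<and> orientation \<eta> = \<sigma> \<and> of_rat q < strength \<eta>)"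
proof
  assume "\<exists>\<eta>\<in>\<omega>. y \<in> influence \<eta> \<and> orientation \<eta> = \<sigma> \<and> of_rat q < strength \<eta>"
  then obtain \<eta> where \<eta>: "\<eta> \<in> \<omega>" "y \<in> influence \<eta>" "orientation \<eta> = \<sigma>" "of_rat q < strength \<eta>"
    by blast
  show "covered \<sigma> q \<omega> y"
    unfolding covered_def
  proof (intro allI impI)
    fix a1 b1 a2 b2 :: rat
    assume "of_rat a1 < fst y \<and> fst y < of_rat b1 \<and> of_rat a2 < snd y \<and> snd y < of_rat b2"
    then have "y \<in> {of_rat a1..of_rat b1} \<times> {of_rat a2..of_rat b2}"
      by (cases y) auto
    then have "\<eta> \<in> meeting ({of_rat a1..of_rat b1} \<times> {of_rat a2..of_rat b2})"
      using \<eta>(2) unfolding meeting_def by blast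
    then show "\<omega> \<inter> {\<eta> \<in> meeting ({of_rat a1..of_rat b1} \<times> {of_rat a2..of_rat b2}).
        orientation \<eta> = \<sigma> \<and> of_rat q < strength \<eta>} \<noteq> {}"
      using \<eta> by auto
  qed
next
  assume cov: "covered \<sigma> q \<omega> y"
  show "\<exists>\<eta>\<in>\<omega>. y \<in> influence \<eta> \<and> orientation \<eta> = \<sigma> \<and> of_rat q < strength \<eta>"
  proof (rule ccontr)
    assume no: "\<not> ?thesis"
    define F where "F = {\<eta> \<in> \<omega>. influence \<eta> \<inter> ball y 1 \<noteq> {} \<and> orientation \<eta> = \<sigma> \<and> of_rat q < strength \<eta>}"
    have "finite {\<eta> \<in> \<omega>. influence \<eta> \<inter> ball y 1 \<noteq> {}}"
      using fin unfolding finite_influence_def by blast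
    then have "finite F"
      by (rule rev_finite_subset) (auto simp: F_def)
    then have "open (ball y 1 - \<Union>(influence ` F))"
      by (intro open_Diff open_ball closed_UN) (auto intro: closed_influence)
    moreover have "y \<in> ball y 1 - \<Union>(influence ` F)"
      using no by (auto simp: F_def)
    ultimately obtain a1 b1 a2 b2 where ab: "of_rat a1 < fst y" "fst y < of_rat b1"
        "of_rat a2 < snd y" "snd y < of_rat b2"
        and Q: "{of_rat a1..of_rat b1} \<times> {of_rat a2..of_rat b2} \<subseteq> ball y 1 - \<Union>(influence ` F)"
      by (rule rat_box)
    let ?Q = "{of_rat a1..of_rat b1} \<times> {of_rat a2..of_rat b2} :: plane set"
    have "\<omega> \<inter> {\<eta> \<in> meeting ?Q. orientation \<eta> = \<sigma> \<and> of_rat q < strength \<eta>} \<noteq> {}"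
      using cov ab by (simp only: covered_def simp_thms)
    then obtain \<eta> where \<eta>: "\<eta> \<in> \<omega>" "\<eta> \<in> meeting ?Q" "orientation \<eta> = \<sigma>" "of_rat q < strength \<eta>"
      by blast
    obtain p where "p \<in> influence \<eta>" "p \<in> ?Q"
      using \<eta>(2) by (auto simp: meeting_def)
    then show False
      using Q \<eta> unfolding F_def by blast
  qed
qed

lemma finite_influence_subset:
  assumes "finite_influence \<omega>" "\<omega>' \<subseteq> \<omega>"
  shows "finite_influence \<omega>'"
  unfolding finite_influence_def
proof (intro allI impI)
  fix K :: "plane set" assume "bounded K"
  then have "finite {\<eta> \<in> \<omega>. influence \<eta> \<inter> K \<noteq> {}}"
    using assms(1) unfolding finite_influence_def by blast
  then show "finite {\<eta> \<in> \<omega>'. influence \<eta> \<inter> K \<noteq> {}}"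
    by (rule rev_finite_subset) (use assms(2) in blast)
qed

lemma threshold_field_cong:
  assumes "finite_influence \<omega>" "\<omega>' \<subseteq> \<omega>" "\<And>\<eta>. \<eta> \<in> \<omega> \<Longrightarrow> y \<in> influence \<eta> \<Longrightarrow> \<eta> \<in> \<omega>'"
  shows "threshold_field \<omega>' y = threshold_field \<omega> y"
proof -
  have "covered \<sigma> q \<omega>' y \<longleftrightarrow> covered \<sigma> q \<omega> y" for \<sigma> q
    unfolding covered_iff[OF assms(1)] covered_iff[OF finite_influence_subset[OF assms(1,2)]]
    using assms(2,3) by blast
  then show ?thesis by (simp only: threshold_field_def)
qed

text \<open>
  Only finitely many points influence \<open>y\<close>, so the maximal strength is attained; as the strengths are
  distinct, the points of the other orientation stay strictly below it and a rational number fits in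
  between.
\<close>

lemma raw_field_eq_threshold_field:
  assumes fin: "finite_influence \<omega>" and inj: "inj_on strength \<omega>"
  shows "raw_field \<omega> = threshold_field \<omega>"
proof
  fix y
  let ?C = "{\<eta> \<in> \<omega>. y \<in> influence \<eta>}"
  have "finite {\<eta> \<in> \<omega>. influence \<eta> \<inter> {y} \<noteq> {}}"
    using fin unfolding finite_influence_def by (meson bounded_empty bounded_insert)
  then have "finite ?C"
    by simp
  note cov = covered_iff[OF fin]
  show "raw_field \<omega> y = threshold_field \<omega> y"
  proof (cases "?C = {}")
    case True
    then have "\<not> covered \<sigma> q \<omega> y" for \<sigma> q
      by (auto simp: cov)
    then show ?thesis
      using True fin by (auto simp: raw_field_def threshold_field_def strongest_def)
  next
    case False
    define m where "m = arg_max_on strength ?C"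
    have m: "m \<in> ?C" "\<And>\<eta>. \<eta> \<in> ?C \<Longrightarrow> strength \<eta> \<le> strength m"
    proof -
      have "Max (strength ` ?C) \<in> strength ` ?C"
        using \<open>finite ?C\<close> False by (intro Max_in) auto
      then obtain \<eta> where \<eta>: "Max (strength ` ?C) = strength \<eta>" "\<eta> \<in> ?C"
        by (rule imageE)
      have "strength \<eta>' \<le> strength \<eta>" if "\<eta>' \<in> ?C" for \<eta>'
        unfolding \<eta>(1)[symmetric] using \<open>finite ?C\<close> that by (intro Max_ge) auto
      with \<eta>(2) have "is_arg_max strength (\<lambda>\<eta>. \<eta> \<in> ?C) \<eta>"
        unfolding is_arg_max_linorder by blast
      then have "is_arg_max strength (\<lambda>\<eta>. \<eta> \<in> ?C) m"
        unfolding m_def arg_max_on_def arg_max_def by (rule someI)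
      then show "m \<in> ?C" "\<And>\<eta>. \<eta> \<in> ?C \<Longrightarrow> strength \<eta> \<le> strength m"
        unfolding is_arg_max_linorder by blast+
    qed
    have raw: "raw_field \<omega> y = unit_vec (orientation m)"
      using fin False by (auto simp: raw_field_def strongest_def m_def)
    have dominated: "covered \<sigma> q \<omega> y \<Longrightarrow> covered (orientation m) q \<omega> y" for \<sigma> q
      using m unfolding cov by force
    have strict: "\<exists>q. covered (orientation m) q \<omega> y \<and> \<not> covered \<sigma> q \<omega> y" if \<sigma>: "\<sigma> \<noteq> orientation m" for \<sigma>
    proof -
      have lt: "strength \<eta> < strength m" if "\<eta> \<in> ?C" "orientation \<eta> = \<sigma>" for \<eta>
        using m(2)[OF that(1)] inj_onD[OF inj, of \<eta> m] that m(1) \<sigma> by force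
      \<comment> \<open>the extra element keeps the set nonempty when no point of orientation \<open>\<sigma>\<close> influences \<open>y\<close>\<close>
      define s where "s = Max (insert (strength m - 1) (strength ` {\<eta> \<in> ?C. orientation \<eta> = \<sigma>}))"
      have fin': "finite (insert (strength m - 1) (strength ` {\<eta> \<in> ?C. orientation \<eta> = \<sigma>}))"
        by (intro finite.insertI finite_imageI finite_subset[OF _ \<open>finite ?C\<close>]) blast
      have "s < strength m"
        unfolding s_def using lt by (subst Max_less_iff[OF fin']) auto
      then obtain q where q: "s < of_rat q" "of_rat q < strength m"
        using of_rat_dense by blast
      have le: "strength \<eta> \<le> s" if "\<eta> \<in> ?C" "orientation \<eta> = \<sigma>" for \<eta>
        unfolding s_def using that by (intro Max_ge[OF fin'] insertI2 imageI) simp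
      have "covered (orientation m) q \<omega> y"
        using m(1) q(2) unfolding cov by blast
      moreover have "\<not> covered \<sigma> q \<omega> y"
      proof
        assume "covered \<sigma> q \<omega> y"
        then obtain \<eta> where "\<eta> \<in> ?C" "orientation \<eta> = \<sigma>" "of_rat q < strength \<eta>"
          unfolding cov by blast
        then show False
          using le[of \<eta>] q(1) by linarith
      qed
      ultimately show ?thesis by blast
    qed
    show ?thesis
    proof (cases "orientation m = 1")
      case True
      then show ?thesis
        using strict[of 2] raw by (auto simp: threshold_field_def)
    next
      case False
      then have "orientation m = 2"
        using exhaust_2 by blast
      then show ?thesis
        using strict[of 1] dominated[of 1] raw by (auto simp: threshold_field_def)
    qed
  qed
qed

lemma influence_translate: "y \<in> influence (translate z \<eta>) \<longleftrightarrow> y - z \<in> influence \<eta>"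
  by (cases \<eta>; cases y; cases z) (auto simp: translate_def influence_iff)

lemma finite_influence_translate:
  assumes "finite_influence \<omega>"
  shows "finite_influence (translate z ` \<omega>)"
  unfolding finite_influence_def
proof (intro allI impI)
  fix K :: "plane set" assume "bounded K"
  then have "bounded ((\<lambda>y. y - z) ` K)"
    using bounded_translation[of K "- z"] by simp
  then have "finite {\<eta> \<in> \<omega>. influence \<eta> \<inter> (\<lambda>y. y - z) ` K \<noteq> {}}"
    using assms by (auto simp: finite_influence_def)
  moreover have "{\<eta> \<in> translate z ` \<omega>. influence \<eta> \<inter> K \<noteq> {}} \<subseteq>
      translate z ` {\<eta> \<in> \<omega>. influence \<eta> \<inter> (\<lambda>y. y - z) ` K \<noteq> {}}"
  proof
    fix \<eta> assume "\<eta> \<in> {\<eta> \<in> translate z ` \<omega>. influence \<eta> \<inter> K \<noteq> {}}"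
    then obtain \<eta>' p where \<eta>': "\<eta> = translate z \<eta>'" "\<eta>' \<in> \<omega>" "p \<in> K" "p \<in> influence (translate z \<eta>')"
      by blast
    then have "p - z \<in> influence \<eta>' \<inter> (\<lambda>y. y - z) ` K"
      unfolding influence_translate by blast
    then show "\<eta> \<in> translate z ` {\<eta> \<in> \<omega>. influence \<eta> \<inter> (\<lambda>y. y - z) ` K \<noteq> {}}"
      using \<eta>' by blast
  qed
  ultimately show "finite {\<eta> \<in> translate z ` \<omega>. influence \<eta> \<inter> K \<noteq> {}}"
    by (rule finite_surj)
qed

lemma threshold_field_translate:
  assumes "finite_influence \<omega>"
  shows "threshold_field (translate z ` \<omega>) y = threshold_field \<omega> (y - z)"
proof -
  have "orientation (translate z \<eta>) = orientation \<eta>" "strength (translate z \<eta>) = strength \<eta>" for \<eta>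
    by (auto simp: translate_def split_beta')
  then have "covered \<sigma> q (translate z ` \<omega>) y \<longleftrightarrow> covered \<sigma> q \<omega> (y - z)" for \<sigma> q
    unfolding covered_iff[OF assms] covered_iff[OF finite_influence_translate[OF assms]]
    by (simp add: influence_translate)
  then show ?thesis by (simp only: threshold_field_def)
qed

lemma finite_influence_iff:
  "finite_influence \<omega> \<longleftrightarrow> (\<forall>n::nat. finite (\<omega> \<inter> meeting (window 0 (real n))))"
proof
  assume "finite_influence \<omega>"
  moreover have "bounded (window 0 M)" for M
    unfolding window_def by (intro bounded_Times bounded_closed_interval)
  ultimately show "\<forall>n::nat. finite (\<omega> \<inter> meeting (window 0 (real n)))"
    by (auto simp: finite_influence_def meeting_def Int_def)
next
  assume fin: "\<forall>n::nat. finite (\<omega> \<inter> meeting (window 0 (real n)))"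
  show "finite_influence \<omega>"
    unfolding finite_influence_def
  proof (intro allI impI)
    fix K :: "plane set" assume "bounded K"
    then obtain n where "K \<subseteq> window 0 (real n)"
      by (rule bounded_subset_window)
    then show "finite {\<eta> \<in> \<omega>. influence \<eta> \<inter> K \<noteq> {}}"
      using fin by (intro finite_subset[OF _ spec[OF fin, of n]]) (auto simp: meeting_def)
  qed
qed

text \<open>
  The boxes are bounded, so the sets of points to be avoided have finite intensity and their void events
  belong to \<open>void_space\<close>.
\<close>

lemma measurable_covered:
  assumes "1 < \<alpha>"
  shows "Measurable.pred (void_space (intensity \<alpha>) \<Otimes>\<^sub>M borel) (\<lambda>p. covered \<sigma> q (fst p) (snd p))"
proof -
  let ?H = "\<lambda>a1 b1 a2 b2. {\<eta> \<in> meeting ({a1..b1} \<times> {a2..b2}). orientation \<eta> = \<sigma> \<and> of_rat q < strength \<eta>}"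
  have [measurable]: "Measurable.pred (void_space (intensity \<alpha>)) (\<lambda>\<omega>. \<omega> \<inter> ?H a1 b1 a2 b2 = {})" for a1 b1 a2 b2
  proof -
    have "?H a1 b1 a2 b2 = meeting ({a1..b1} \<times> {a2..b2}) \<inter>
        {\<eta> \<in> space point_space. orientation \<eta> = \<sigma> \<and> of_rat q < strength \<eta>}"
      by auto
    moreover have "\<dots> \<in> sets point_space"
      by measurable
    ultimately have H: "?H a1 b1 a2 b2 \<in> sets (intensity \<alpha>)"
      by simp
    have "bounded ({a1..b1} \<times> {a2..b2})"
      by (intro bounded_Times bounded_closed_interval)
    then have "emeasure (intensity \<alpha>) (meeting ({a1..b1} \<times> {a2..b2})) < \<infinity>"
      by (rule emeasure_meeting_finite[OF assms])
    then have "emeasure (intensity \<alpha>) (?H a1 b1 a2 b2) < \<infinity>"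
      by (rule le_less_trans[OF emeasure_mono, rotated 2]) auto
    from void_in_void_space[OF H this] show ?thesis
      by (simp add: pred_def void_def)
  qed
  have [measurable]: "fst \<in> (borel :: plane measure) \<rightarrow>\<^sub>M (borel :: real measure)"
      "snd \<in> (borel :: plane measure) \<rightarrow>\<^sub>M (borel :: real measure)"
    by (intro borel_measurable_continuous_onI continuous_intros)+
  show ?thesis
    unfolding covered_def by measurable
qed

lemma measurable_threshold_field:
  assumes "1 < \<alpha>"
  shows "(\<lambda>p. threshold_field (fst p) (snd p)) \<in> borel_measurable (void_space (intensity \<alpha>) \<Otimes>\<^sub>M borel)"
proof -
  note measurable_covered[OF assms, measurable]
  show ?thesis unfolding threshold_field_def by measurable
qed

lemma norm_threshold_field: "norm (threshold_field \<omega> y) \<le> 1"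
  by (auto simp: threshold_field_def unit_vec_def norm_Pair real_sqrt_le_1_iff power2_eq_square)

section \<open>Mollification\<close>

definition mollify :: "(plane \<Rightarrow> real) \<Rightarrow> (plane \<Rightarrow> plane) \<Rightarrow> plane \<Rightarrow> plane"
  where "mollify \<rho> g x = (\<integral>y. \<rho> (x - y) *\<^sub>R g y \<partial>lborel)"

locale kernel =
  fixes \<rho> :: "plane \<Rightarrow> real"
  assumes kernel: "smoothing_kernel \<rho>"
begin

lemma continuous_kernel: "continuous_on UNIV \<rho>"
  using kernel by (auto simp: smoothing_kernel_def smooth_def dest: spec[of _ 0])

lemma measurable_kernel [measurable]: "\<rho> \<in> borel_measurable borel"
  by (rule borel_measurable_continuous_onI[OF continuous_kernel])

lemma kernel_support:
  assumes "\<rho> x \<noteq> 0" shows "- (1 / 3) \<le> fst x" "fst x \<le> 0" "- (1 / 3) \<le> snd x" "snd x \<le> 0"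
proof -
  have "closure {x. \<rho> x \<noteq> 0} \<subseteq> {- (1 / 3)..0} \<times> {- (1 / 3)..0}"
    using kernel unfolding smoothing_kernel_def by (elim conjE)
  moreover have "x \<in> closure {x. \<rho> x \<noteq> 0}"
    using assms by (intro subsetD[OF closure_subset]) simp
  ultimately have "x \<in> {- (1 / 3)..0} \<times> {- (1 / 3)..0}"
    by (rule subsetD)
  then show "- (1 / 3) \<le> fst x" "fst x \<le> 0" "- (1 / 3) \<le> snd x" "snd x \<le> 0"
    by (auto simp: mem_Times_iff)
qed

lemma bounded_kernel: obtains C where "0 \<le> C" "\<And>x. \<bar>\<rho> x\<bar> \<le> C"
proof -
  have "compact ({- (1 / 3)..0} \<times> {- (1 / 3)..0} :: plane set)"
    by (intro compact_Times compact_Icc)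
  then have "bounded (\<rho> ` ({- (1 / 3)..0} \<times> {- (1 / 3)..0}))"
    by (intro compact_imp_bounded compact_continuous_image continuous_on_subset[OF continuous_kernel]) auto
  then obtain C where C: "\<And>x. x \<in> {- (1 / 3)..0} \<times> {- (1 / 3)..0} \<Longrightarrow> \<bar>\<rho> x\<bar> \<le> C"
    by (auto simp: bounded_iff)
  have "\<bar>\<rho> x\<bar> \<le> max C 0" for x
    using C[of x] kernel_support[of x] by (cases "\<rho> x = 0") (auto simp: mem_Times_iff)
  then show ?thesis by (intro that[of "max C 0"]) auto
qed

text \<open>
  The support of \<open>\<rho>\<close> in \<open>[-1/3, 0]\<^sup>2\<close> makes the value at \<open>x\<close> depend on the values in \<open>x + [0, 1/3]\<^sup>2\<close>.
\<close>

lemma mollify_cong: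
  assumes "\<And>y. y \<in> window z (N + 1) \<Longrightarrow> g y = h y" and x: "x \<in> window z N"
  shows "mollify \<rho> g x = mollify \<rho> h x"
proof -
  have "\<rho> (x - y) *\<^sub>R g y = \<rho> (x - y) *\<^sub>R h y" for y
  proof (cases "\<rho> (x - y) = 0")
    case False
    from kernel_support[OF this] x have "y \<in> window z (N + 1)"
      by (auto simp: window_def mem_Times_iff)
    then show ?thesis using assms(1) by simp
  qed simp
  then show ?thesis by (simp only: mollify_def)
qed

text \<open>
  Dominated convergence along a convergent sequence of locations: the kernels are bounded and vanish
  outside a common ball.
\<close>

lemma mollify_in_vfields:
  assumes g [measurable]: "g \<in> borel_measurable borel" and bd: "\<And>y. norm (g y) \<le> 1"
  shows "mollify \<rho> g \<in> vfields"
  unfolding vfields_def mem_Collect_eq continuous_on_sequentially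
proof (intro ballI allI impI, elim conjE)
  fix u :: "nat \<Rightarrow> plane" and x assume lim: "u \<longlonglongrightarrow> x"
  obtain C where C: "0 \<le> C" "\<And>x. \<bar>\<rho> x\<bar> \<le> C"
    using bounded_kernel by blast
  obtain R where R: "\<And>n. norm (u n) \<le> R"
    using convergent_imp_Bseq[OF convergentI[OF lim]] unfolding Bseq_def by blast
  show "(mollify \<rho> g \<circ> u) \<longlonglongrightarrow> mollify \<rho> g x"
    unfolding mollify_def comp_def
  proof (rule integral_dominated_convergence)
    show "integrable lborel (\<lambda>y. C * indicator (cball 0 (R + 1)) y)"
      by (intro integrable_mult_right integrable_real_indicator emeasure_bounded_finite) auto
    show "AE y in lborel. (\<lambda>n. \<rho> (u n - y) *\<^sub>R g y) \<longlonglongrightarrow> \<rho> (x - y) *\<^sub>R g y"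
    proof (intro AE_I2 tendsto_scaleR tendsto_const)
      fix y
      have "isCont \<rho> (x - y)"
        using continuous_on_interior[OF continuous_kernel] by simp
      then show "(\<lambda>n. \<rho> (u n - y)) \<longlonglongrightarrow> \<rho> (x - y)"
        by (rule isCont_tendsto_compose) (intro tendsto_diff lim tendsto_const)
    qed
    show "AE y in lborel. norm (\<rho> (u n - y) *\<^sub>R g y) \<le> C * indicator (cball 0 (R + 1)) y" for n
    proof (rule AE_I2)
      fix y
      show "norm (\<rho> (u n - y) *\<^sub>R g y) \<le> C * indicator (cball 0 (R + 1)) y"
      proof (cases "\<rho> (u n - y) = 0")
        case True
        then show ?thesis using C by simp
      next
        case False
        \<comment> \<open>\<open>u n - y\<close> lies in \<open>[-1/3, 0]\<^sup>2\<close>, whose elements have norm below \<open>1\<close>\<close>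
        have "norm (u n - y) \<le> \<bar>fst (u n - y)\<bar> + \<bar>snd (u n - y)\<bar>"
          using sqrt_sum_squares_le_sum_abs[of "fst (u n - y)" "snd (u n - y)"]
          by (simp add: norm_prod_def)
        then have "norm (u n - y) \<le> 1"
          using kernel_support[OF False] by simp
        then have "y \<in> cball 0 (R + 1)"
          using R[of n] norm_triangle_sub[of y "u n"] by (simp add: norm_minus_commute)
        then show ?thesis
          using C bd[of y] mult_mono[of "\<bar>\<rho> (u n - y)\<bar>" C "norm (g y)" 1] by simp
      qed
    qed
    show "(\<lambda>y. \<rho> (x - y) *\<^sub>R g y) \<in> borel_measurable lborel"
        "(\<lambda>y. \<rho> (u n - y) *\<^sub>R g y) \<in> borel_measurable lborel" for n
      by measurable
  qed
qed

lemma mollify_translate: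
  assumes g [measurable]: "g \<in> borel_measurable borel"
  shows "mollify \<rho> (\<lambda>y. g (y - z)) x = mollify \<rho> g (x - z)"
proof -
  have "mollify \<rho> (\<lambda>y. g (y - z)) x =
      (\<integral>y. \<rho> (x - y) *\<^sub>R g (y - z) \<partial>distr lborel borel ((+) z))"
    by (simp add: mollify_def lborel_distr_plus)
  also have "\<dots> = (\<integral>y. \<rho> (x - (z + y)) *\<^sub>R g (z + y - z) \<partial>lborel)"
  proof (rule integral_distr)
    show "(+) z \<in> lborel \<rightarrow>\<^sub>M borel"
      by simp
    show "(\<lambda>y. \<rho> (x - y) *\<^sub>R g (y - z)) \<in> borel_measurable borel"
      by measurable
  qed
  also have "\<dots> = mollify \<rho> g (x - z)"
    by (simp add: mollify_def algebra_simps)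
  finally show ?thesis .
qed

end

section \<open>Mixing\<close>

text \<open>
  The mollified threshold field of the configuration is measurable on \<open>void_space\<close> and almost surely equal
  to the smooth field; all probabilities below are computed with it.
\<close>

locale mixing_setup = kernel \<rho> + poisson "intensity \<alpha>" P
  for \<rho> :: "plane \<Rightarrow> real" and \<alpha> :: real and P :: "config measure" +
  assumes \<alpha>: "1 < \<alpha>"
begin

abbreviation config_field :: "config \<Rightarrow> plane \<Rightarrow> plane"
  where "config_field \<omega> \<equiv> mollify \<rho> (threshold_field \<omega>)"

lemma measurable_threshold_section [measurable]: "threshold_field \<omega> \<in> borel_measurable borel"
  using measurable_compose[OF measurable_Pair1' measurable_threshold_field[OF \<alpha>], of \<omega>] by simp

lemma config_field_in_vfields: "config_field \<omega> \<in> vfields"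
  by (intro mollify_in_vfields measurable_threshold_section norm_threshold_field)

lemma measurable_config_field [measurable]:
  "config_field \<in> void_space (intensity \<alpha>) \<rightarrow>\<^sub>M vfield_space"
proof (rule measurable_vfield_spaceI)
  fix x
  note measurable_threshold_field[OF \<alpha>, measurable]
  have "(\<lambda>(\<omega>, y). \<rho> (x - y) *\<^sub>R threshold_field \<omega> y) \<in> borel_measurable (void_space (intensity \<alpha>) \<Otimes>\<^sub>M lborel)"
    using measurable_threshold_field[OF \<alpha>] by (simp add: split_beta')
  then show "(\<lambda>\<omega>. config_field \<omega> x) \<in> borel_measurable (void_space (intensity \<alpha>))"
    unfolding mollify_def by (rule lborel.borel_measurable_lebesgue_integral)
qed (rule config_field_in_vfields)

lemma AE_finite_influence: "AE \<omega> in P. finite_influence \<omega>"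
  unfolding finite_influence_iff AE_all_countable
proof
  fix n :: nat
  have "bounded (window 0 (real n))"
    unfolding window_def by (intro bounded_Times bounded_closed_interval)
  then show "AE \<omega> in P. finite (\<omega> \<inter> meeting (window 0 (real n)))"
    by (intro AE_finite emeasure_meeting_finite[OF \<alpha>]) simp_all
qed

lemma pred_finite_influence: "Measurable.pred P finite_influence"
proof -
  have [measurable]: "Measurable.pred P (\<lambda>\<omega>. finite (\<omega> \<inter> meeting (window 0 (real n))))" for n
    using finite_event[of "meeting (window 0 (real n))"] by (simp add: pred_def)
  show ?thesis
    unfolding finite_influence_iff[abs_def] by measurable
qed

text \<open>
  The second alternative does not depend on \<open>\<omega>\<close>; so measurability of the smooth field follows from that of
  \<open>config_field\<close> and of \<open>finite_influence\<close>.
\<close>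

lemma smooth_field_eq:
  assumes "\<omega> \<in> space P"
  shows "smooth_field \<rho> \<omega> = (if finite_influence \<omega> then config_field \<omega>
    else mollify \<rho> (\<lambda>_. (1 / 2) *\<^sub>R (unit_vec 1 + unit_vec 2)))"
proof -
  have "inj_on strength \<omega>"
    using assms by (simp add: space_P configs_def)
  then have "raw_field \<omega> = (if finite_influence \<omega> then threshold_field \<omega>
      else (\<lambda>_. (1 / 2) *\<^sub>R (unit_vec 1 + unit_vec 2)))"
    using raw_field_eq_threshold_field[of \<omega>] by (auto simp: raw_field_def fun_eq_iff)
  moreover have "smooth_field \<rho> \<omega> = mollify \<rho> (raw_field \<omega>)"
    by (rule ext) (simp only: smooth_field_def mollify_def)
  ultimately show ?thesis
    by simp
qed

lemma measurable_smooth_field: "smooth_field \<rho> \<in> P \<rightarrow>\<^sub>M vfield_space"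
proof -
  let ?c = "(1 / 2) *\<^sub>R (unit_vec 1 + unit_vec 2)"
  have "norm ?c \<le> 1"
    by (simp add: unit_vec_def norm_Pair real_sqrt_le_1_iff power2_eq_square)
  then have "mollify \<rho> (\<lambda>_. ?c) \<in> vfields"
    by (intro mollify_in_vfields) auto
  then have "(\<lambda>\<omega>. if finite_influence \<omega> then config_field \<omega> else mollify \<rho> (\<lambda>_. ?c)) \<in> P \<rightarrow>\<^sub>M vfield_space"
    by (intro measurable_If pred_finite_influence[unfolded pred_def]
        measurable_compose[OF measurable_ident_void_space measurable_config_field]) auto
  then show ?thesis
    by (subst measurable_cong[OF smooth_field_eq])
qed

lemma field_law_eq:
  assumes A: "A \<in> sets vfield_space"
  shows "measure (field_law \<rho> P) A = prob {\<omega> \<in> space P. config_field \<omega> \<in> A}"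
proof -
  note measurable_compose[OF measurable_ident_void_space measurable_config_field, measurable]
    measurable_smooth_field [measurable] A[measurable]
  have "measure (field_law \<rho> P) A = prob {\<omega> \<in> space P. smooth_field \<rho> \<omega> \<in> A}"
    unfolding field_law_def using A measurable_smooth_field
    by (simp add: measure_distr vimage_def Int_def conj_commute)
  also have "\<dots> = prob {\<omega> \<in> space P. config_field \<omega> \<in> A}"
  proof (rule finite_measure_eq_AE)
    show "AE \<omega> in P. \<omega> \<in> {\<omega> \<in> space P. smooth_field \<rho> \<omega> \<in> A} \<longleftrightarrow> \<omega> \<in> {\<omega> \<in> space P. config_field \<omega> \<in> A}"
      using AE_finite_influence AE_space
      by eventually_elim (auto simp: smooth_field_eq)
  qed measurable
  finally show ?thesis .
qed

lemma config_field_local: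
  assumes fin: "finite_influence \<omega>" and sub: "\<omega>' \<subseteq> \<omega>" "\<omega> \<inter> meeting (window z (N + 1)) \<subseteq> \<omega>'"
    and x: "x \<in> window z N"
  shows "config_field \<omega>' x = config_field \<omega> x"
proof (rule mollify_cong[OF _ x])
  fix y assume "y \<in> window z (N + 1)"
  then show "threshold_field \<omega>' y = threshold_field \<omega> y"
    using sub(2) by (intro threshold_field_cong[OF fin sub(1)]) (auto simp: meeting_def)
qed

lemma config_field_translate:
  assumes "finite_influence \<omega>"
  shows "config_field (translate z ` \<omega>) = shift (- z) (config_field \<omega>)"
proof
  fix x
  have "config_field (translate z ` \<omega>) x = mollify \<rho> (\<lambda>y. threshold_field \<omega> (y - z)) x"
    using threshold_field_translate[OF assms] by (simp add: mollify_def)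
  then show "config_field (translate z ` \<omega>) x = shift (- z) (config_field \<omega>) x"
    by (simp add: mollify_translate shift_def)
qed

text \<open>
  Shifting the field amounts to translating the points, which does not change the law of the process.
\<close>

lemma prob_shift:
  assumes B: "B \<in> sets vfield_space"
  shows "prob {\<omega> \<in> space P. config_field \<omega> \<in> shift z ` B} = prob {\<omega> \<in> space P. config_field \<omega> \<in> B}"
proof -
  have T: "translate z \<in> intensity \<alpha> \<rightarrow>\<^sub>M intensity \<alpha>"
    by measurable
  have b: "config_field -` B \<in> sets (void_space (intensity \<alpha>))"
    using measurable_sets[OF measurable_config_field B] by simp
  have im: "(\<lambda>\<omega>. translate z ` \<omega>) \<in> P \<rightarrow>\<^sub>M void_space (intensity \<alpha>)"
    using measurable_compose[OF measurable_ident_void_space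
        measurable_image_config[OF T intensity_translate space_intensity]] .
  note measurable_compose[OF measurable_ident_void_space measurable_config_field, measurable]
    measurable_compose[OF im measurable_config_field, measurable] B[measurable]
    sets_shift_image[OF B, measurable]
  have "prob {\<omega> \<in> space P. config_field \<omega> \<in> shift z ` B} =
      prob {\<omega> \<in> space P. config_field (translate z ` \<omega>) \<in> B}"
  proof (rule finite_measure_eq_AE)
    show "AE \<omega> in P. \<omega> \<in> {\<omega> \<in> space P. config_field \<omega> \<in> shift z ` B} \<longleftrightarrow>
        \<omega> \<in> {\<omega> \<in> space P. config_field (translate z ` \<omega>) \<in> B}"
      using AE_finite_influence
      by eventually_elim (simp add: config_field_translate shift_image)
  qed measurable
  also have "\<dots> = prob {\<omega> \<in> space P. config_field \<omega> \<in> B}"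
    using prob_image_invariant[OF T intensity_translate space_intensity b] by simp
  finally show ?thesis .
qed

end

lemma (in prob_space) prob_diff_le:
  assumes "X \<in> events" "X' \<in> events" "H \<in> events"
    and "AE \<omega> in M. \<omega> \<notin> H \<longrightarrow> (\<omega> \<in> X \<longleftrightarrow> \<omega> \<in> X')"
  shows "\<bar>prob X - prob X'\<bar> \<le> prob H"
proof -
  have "prob U \<le> prob V + prob H" if "U \<in> events" "V \<in> events"
    "AE \<omega> in M. \<omega> \<notin> H \<longrightarrow> (\<omega> \<in> U \<longleftrightarrow> \<omega> \<in> V)" for U V
  proof -
    have "prob U \<le> prob (V \<union> H)"
      using that assms(3) by (intro finite_measure_mono_AE) (auto elim!: eventually_mono)
    also have "\<dots> \<le> prob V + prob H"
      using that assms(3) by (intro measure_Un_le)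
    finally show ?thesis .
  qed
  from this[OF assms(1,2,4)] this[OF assms(2,1)] assms(4) show ?thesis
    by (auto simp: abs_le_iff eq_commute)
qed

lemma local_events_cong:
  assumes "A \<in> local_events N" "u \<in> vfields" "w \<in> vfields"
    and "\<And>x. x \<in> square N \<Longrightarrow> u x = w x"
  shows "u \<in> A \<longleftrightarrow> w \<in> A"
proof -
  have "restrict u (square N) = restrict w (square N)"
    using assms(4) by (auto simp: restrict_def)
  then show ?thesis
    using assms(1-3) by (auto simp: local_events_def)
qed

context mixing_setup begin

text \<open>
  Off the event \<open>H\<close> that a point falls into \<open>D\<close>, the field on the first window is that of \<open>\<omega> \<inter> E\<close> and the
  field on the second one that of \<open>\<omega> \<inter> F\<close>, with \<open>E\<close> and \<open>F\<close> disjoint. So the events \<open>X\<close> and \<open>Y\<close> of interest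
  can be exchanged for independent events \<open>X'\<close> and \<open>Y'\<close>, with an error of \<open>P H\<close> for each of \<open>P (X \<inter> Y)\<close>, \<open>P X\<close>
  and \<open>P Y\<close>.
\<close>

lemma mixing_bound:
  fixes z :: plane and N :: real
  assumes A: "A \<in> local_events N" and B: "B \<in> local_events N" and N: "0 < N"
  defines "D \<equiv> meeting (window 0 (N + 1)) \<inter> meeting (window z (N + 1))"
  shows "\<bar>measure (field_law \<rho> P) (A \<inter> shift z ` B) - measure (field_law \<rho> P) A * measure (field_law \<rho> P) B\<bar>
    \<le> 3 * measure (intensity \<alpha>) D"
proof -
  let ?\<V> = "void_space (intensity \<alpha>)"
  define E where "E = meeting (window 0 (N + 1)) - D"
  define F where "F = meeting (window z (N + 1)) - D"
  define a where "a = config_field -` A"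
  define b where "b = config_field -` (shift z ` B)"
  have sA: "A \<in> sets vfield_space" and sB: "B \<in> sets vfield_space"
    using A B by (auto simp: local_events_def)
  note sB' = sets_shift_image[OF sB, of z]
  have a: "a \<in> sets ?\<V>" and b: "b \<in> sets ?\<V>"
    using measurable_sets[OF measurable_config_field sA] measurable_sets[OF measurable_config_field sB']
    by (auto simp: a_def b_def)
  have D: "D \<in> sets (intensity \<alpha>)" and E: "E \<in> sets (intensity \<alpha>)" and F: "F \<in> sets (intensity \<alpha>)"
    unfolding D_def E_def F_def by auto
  define H where "H = {\<omega> \<in> space P. \<omega> \<inter> D \<noteq> {}}"
  define X where "X = {\<omega> \<in> space P. \<omega> \<in> a}"
  define Y where "Y = {\<omega> \<in> space P. \<omega> \<in> b}"
  define X' where "X' = {\<omega> \<in> space P. \<omega> \<inter> E \<in> a}"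
  define Y' where "Y' = {\<omega> \<in> space P. \<omega> \<inter> F \<in> b}"
  have meas: "X \<in> events" "Y \<in> events" "X' \<in> events" "Y' \<in> events"
    unfolding X_def Y_def X'_def Y'_def
    using measurable_sets[OF measurable_ident_void_space a]
      measurable_sets[OF measurable_ident_void_space b]
      measurable_sets[OF measurable_compose[OF measurable_ident_void_space measurable_restrict_config[OF E]] a]
      measurable_sets[OF measurable_compose[OF measurable_ident_void_space measurable_restrict_config[OF F]] b]
    by (simp_all add: vimage_def Int_def conj_commute)
  have "H = space P - {\<omega> \<in> space P. \<omega> \<inter> D = {}}"
    by (auto simp: H_def)
  then have H: "H \<in> events" and prob_H: "prob H = 1 - prob {\<omega> \<in> space P. \<omega> \<inter> D = {}}"
    using void_event[OF D] by (auto simp: prob_compl)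
  have "emeasure (intensity \<alpha>) D < \<infinity>"
  proof -
    have "bounded (window 0 (N + 1))"
      unfolding window_def by (intro bounded_Times bounded_closed_interval)
    from emeasure_meeting_finite[OF \<alpha> this] show ?thesis
      by (rule le_less_trans[rotated]) (auto simp: D_def intro!: emeasure_mono)
  qed
  then have h: "prob H \<le> measure (intensity \<alpha>) D"
    using prob_void[OF D] exp_ge_add_one_self[of "- measure (intensity \<alpha>) D"] by (simp add: prob_H)
  have XX': "AE \<omega> in P. \<omega> \<notin> H \<longrightarrow> (\<omega> \<in> X \<longleftrightarrow> \<omega> \<in> X')"
    using AE_finite_influence AE_space
  proof eventually_elim
    fix \<omega> assume fin: "finite_influence \<omega>" and \<omega>: "\<omega> \<in> space P"
    show "\<omega> \<notin> H \<longrightarrow> (\<omega> \<in> X \<longleftrightarrow> \<omega> \<in> X')"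
    proof
      assume "\<omega> \<notin> H"
      then have sub: "\<omega> \<inter> meeting (window 0 (N + 1)) \<subseteq> \<omega> \<inter> E"
        using \<omega> by (auto simp: H_def E_def)
      have "config_field (\<omega> \<inter> E) \<in> A \<longleftrightarrow> config_field \<omega> \<in> A"
        using config_field_local[OF fin _ sub] config_field_in_vfields
        by (intro local_events_cong[OF A]) (auto simp: window_def square_def)
      then show "\<omega> \<in> X \<longleftrightarrow> \<omega> \<in> X'"
        using \<omega> by (simp add: X_def X'_def a_def)
    qed
  qed
  have YY': "AE \<omega> in P. \<omega> \<notin> H \<longrightarrow> (\<omega> \<in> Y \<longleftrightarrow> \<omega> \<in> Y')"
    using AE_finite_influence AE_space
  proof eventually_elim
    fix \<omega> assume fin: "finite_influence \<omega>" and \<omega>: "\<omega> \<in> space P"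
    show "\<omega> \<notin> H \<longrightarrow> (\<omega> \<in> Y \<longleftrightarrow> \<omega> \<in> Y')"
    proof
      assume "\<omega> \<notin> H"
      then have sub: "\<omega> \<inter> meeting (window z (N + 1)) \<subseteq> \<omega> \<inter> F"
        using \<omega> by (auto simp: H_def F_def)
      have "shift (- z) (config_field (\<omega> \<inter> F)) x = shift (- z) (config_field \<omega>) x"
        if "x \<in> square N" for x
      proof -
        have "x - z \<in> window z N"
          using that by (auto simp: window_def square_def mem_Times_iff)
        from config_field_local[OF fin _ sub this] show ?thesis
          by (simp add: shift_def)
      qed
      then have "shift (- z) (config_field (\<omega> \<inter> F)) \<in> B \<longleftrightarrow> shift (- z) (config_field \<omega>) \<in> B"
        using config_field_in_vfields by (intro local_events_cong[OF B]) auto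
      then show "\<omega> \<in> Y \<longleftrightarrow> \<omega> \<in> Y'"
        using \<omega> by (simp add: Y_def Y'_def b_def shift_image)
    qed
  qed
  have indep: "prob (X' \<inter> Y') = prob X' * prob Y'"
  proof -
    have "X' \<inter> Y' = {\<omega> \<in> space P. \<omega> \<inter> E \<in> a \<and> \<omega> \<inter> F \<in> b}"
      by (auto simp: X'_def Y'_def)
    moreover have "E \<inter> F = {}"
      by (auto simp: E_def F_def D_def)
    ultimately show ?thesis
      using prob_restrict_indep[OF E F _ a b] by (simp add: X'_def Y'_def)
  qed
  have 1: "\<bar>prob (X \<inter> Y) - prob (X' \<inter> Y')\<bar> \<le> prob H"
    using meas H XX' YY' by (intro prob_diff_le) (auto elim!: eventually_elim2)
  have 2: "\<bar>prob X - prob X'\<bar> \<le> prob H" and 3: "\<bar>prob Y - prob Y'\<bar> \<le> prob H"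
    using meas H XX' YY' by (auto intro!: prob_diff_le)
  have "\<bar>prob (X \<inter> Y) - prob X * prob Y\<bar> \<le> 3 * prob H"
  proof -
    have "prob (X \<inter> Y) - prob X * prob Y = (prob (X \<inter> Y) - prob (X' \<inter> Y')) +
        prob X' * (prob Y' - prob Y) + prob Y * (prob X' - prob X)"
      by (simp add: indep algebra_simps)
    also have "\<bar>\<dots>\<bar> \<le> \<bar>prob (X \<inter> Y) - prob (X' \<inter> Y')\<bar> + \<bar>prob X' * (prob Y' - prob Y)\<bar> +
        \<bar>prob Y * (prob X' - prob X)\<bar>"
      by linarith
    also have "\<bar>prob X' * (prob Y' - prob Y)\<bar> \<le> 1 * prob H"
      unfolding abs_mult using 3 by (intro mult_mono) (auto simp: abs_minus_commute)
    also have "\<bar>prob Y * (prob X' - prob X)\<bar> \<le> 1 * prob H"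
      unfolding abs_mult using 2 by (intro mult_mono) (auto simp: abs_minus_commute)
    finally show ?thesis using 1 by linarith
  qed
  moreover have "measure (field_law \<rho> P) (A \<inter> shift z ` B) = prob (X \<inter> Y)"
  proof -
    have "{\<omega> \<in> space P. config_field \<omega> \<in> A \<inter> shift z ` B} = X \<inter> Y"
      by (auto simp: X_def Y_def a_def b_def)
    then show ?thesis
      using field_law_eq[OF sets.Int[OF sA sB']] by simp
  qed
  moreover have "measure (field_law \<rho> P) A = prob X"
    using field_law_eq[OF sA] by (simp add: X_def a_def)
  moreover have "measure (field_law \<rho> P) B = prob Y"
    using field_law_eq[OF sB] prob_shift[OF sB, of z] by (simp add: Y_def b_def)
  ultimately show ?thesis using h by simp
qed

end

theorem lemma2p2:
  fixes \<alpha> :: real and \<rho> :: "plane \<Rightarrow> real" and P :: "config measure"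
  assumes "1 < \<alpha>" and "\<alpha> \<le> 2"
    and "poisson_process (intensity \<alpha>) P"
    and "smoothing_kernel \<rho>"
  shows "polynomially_mixing (field_law \<rho> P) (\<alpha> - 1)"
proof -
  interpret mixing_setup \<rho> \<alpha> P
    by unfold_locales (use assms in auto)
  show ?thesis
    unfolding polynomially_mixing_def
  proof (intro allI impI ballI)
    fix N :: real and A B assume N: "0 < N" and A: "A \<in> local_events N" and B: "B \<in> local_events N"
    define C where "C = 3 * ((2 * (N + 1) + 1) * (\<alpha> / (\<alpha> - 1) * Gamma (\<alpha> + 1) * 2 powr (\<alpha> - 1)))"
    let ?c = "\<lambda>z. \<bar>measure (field_law \<rho> P) (A \<inter> shift z ` B) -
        measure (field_law \<rho> P) A * measure (field_law \<rho> P) B\<bar>"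
    have bound: "l1_norm z powr (\<alpha> - 1) * ?c z \<le> C" if z: "8 * (N + 1) + 2 \<le> l1_norm z" for z
    proof -
      have "?c z \<le> C * l1_norm z powr (1 - \<alpha>)"
        using mixing_bound[OF A B N, of z] measure_meeting_two_windows[OF \<alpha>, of "N + 1" z] N z
        unfolding C_def by linarith
      then have "l1_norm z powr (\<alpha> - 1) * ?c z \<le> l1_norm z powr (\<alpha> - 1) * (C * l1_norm z powr (1 - \<alpha>))"
        by (intro mult_left_mono) auto
      also have "\<dots> = C"
        using N z by (simp add: powr_diff)
      finally show ?thesis .
    qed
    have "eventually (\<lambda>z. ereal (l1_norm z powr (\<alpha> - 1) * ?c z) \<le> ereal C) (filtercomap l1_norm at_top)"
      unfolding eventually_filtercomap_at_top_linorder
      using bound by (intro exI[of _ "8 * (N + 1) + 2"]) simp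
    then have "Limsup (filtercomap l1_norm at_top) (\<lambda>z. ereal (l1_norm z powr (\<alpha> - 1) * ?c z)) \<le> ereal C"
      by (rule Limsup_bounded)
    then show "Limsup (filtercomap l1_norm at_top) (\<lambda>z. ereal (l1_norm z powr (\<alpha> - 1) * ?c z)) < \<infinity>"
      by (rule le_less_trans) simp
  qed
qed

end
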